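(* Let $h$ be an element of the comeager conjugacy class of $\mathcal H(\{0,1\}^{\mathbb N})$. Then: (a) $P(h)$ is empty. (b) $R(h) = \Omega(h) = CR(h)$. (c) $R(h)$ is a Cantor set with empty interior in $\{0,1\}^{\mathbb N}$.
   Context: $\{0,1\}^{\mathbb N}$ ($\mathbb N$ the positive integers) has the product topology and the metric $d(\sigma,\tau)=1/n$, where $n$ is the least positive integer with $\sigma(n)\neq\tau(n)$, and $d(\sigma,\sigma)=0$. $\mathcal H(\{0,1\}^{\mathbb N})$ is the group of all homeomorphisms of $\{0,1\}^{\mathbb N}$ onto itself, with the topology given by the metric $\tilde d(f,g)=\max_\sigma d(f(\sigma),g(\sigma))$. This group has a conjugacy class that is a comeager subset (necessarily unique), called the comeager conjugacy class of $\mathcal H(\{0,1\}^{\mathbb N})$. For a continuous self-map $f$ of a metric space $X$: $P(f)$ is the set of periodic points ($f^n(x)=x$ for some $n\ge1$); $R(f)$ is the set of recurrent points ($x\in\omega(x,f)$, where $\omega(x,f)$ is the set of limits of convergent subsequences of $(f^n(x))_{n\in\mathbb N}$); $\Omega(f)$ is the set of nonwandering points (for every neighborhood $U$ of $x$ there is $n\ge1$ with $f^n(U)\cap U\ne\emptyset$); $CR(f)$ is the set of chain recurrent points (for every $\delta>0$ there are $n\ge1$ and $x_0=x,x_1,\dots,x_n=x$ in $X$ with $d(f(x_i),x_{i+1})<\delta$ for $0\le i<n$). A Cantor set is a nonempty compact, $0$-dimensional metric space without isolated points. *)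

theory Defs
  imports "HOL-Analysis.Analysis"
begin

section \<open>Recurrence in metric spaces\<close>

context Metric_space
begin

definition periodic_points :: "('a \<Rightarrow> 'a) \<Rightarrow> 'a set" where
  "periodic_points f = {x \<in> M. \<exists>n\<ge>1. (f ^^ n) x = x}"

definition omega_limit_set :: "('a \<Rightarrow> 'a) \<Rightarrow> 'a \<Rightarrow> 'a set" where
  "omega_limit_set f x =
    {y. \<exists>r::nat \<Rightarrow> nat. strict_mono r \<and>
        limitin mtopology ((\<lambda>n. (f ^^ Suc n) x) \<circ> r) y sequentially}"

definition recurrent_points :: "('a \<Rightarrow> 'a) \<Rightarrow> 'a set" where
  "recurrent_points f = {x \<in> M. x \<in> omega_limit_set f x}"

definition nonwandering_points :: "('a \<Rightarrow> 'a) \<Rightarrow> 'a set" where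
  "nonwandering_points f =
    {x \<in> M. \<forall>U. openin mtopology U \<and> x \<in> U \<longrightarrow> (\<exists>n\<ge>1. (f ^^ n) ` U \<inter> U \<noteq> {})}"

definition chain_recurrent_points :: "('a \<Rightarrow> 'a) \<Rightarrow> 'a set" where
  "chain_recurrent_points f =
    {x \<in> M. \<forall>\<delta>>0. \<exists>n\<ge>1. \<exists>p::nat \<Rightarrow> 'a.
        p 0 = x \<and> p n = x \<and> (\<forall>i\<le>n. p i \<in> M) \<and>
        (\<forall>i<n. d (f (p i)) (p (Suc i)) < \<delta>)}"

end

section \<open>Cantor sets and Baire category\<close>

text \<open>Here \<open>dim_le\<close> is the small inductive dimension; \<open>X dim_le 0\<close> says that the clopen sets
  form a base.\<close>

definition Cantor_space :: "'a topology \<Rightarrow> bool" where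
  "Cantor_space X \<longleftrightarrow> topspace X \<noteq> {} \<and> metrizable_space X \<and> compact_space X \<and> X dim_le 0 \<and>
     (\<forall>x\<in>topspace X. \<not> openin X {x})"

abbreviation Cantor_set_in :: "'a topology \<Rightarrow> 'a set \<Rightarrow> bool" where
  "Cantor_set_in X S \<equiv> S \<subseteq> topspace X \<and> Cantor_space (subtopology X S)"

definition nowhere_dense_in :: "'a topology \<Rightarrow> 'a set \<Rightarrow> bool" where
  "nowhere_dense_in X S \<longleftrightarrow> S \<subseteq> topspace X \<and> X interior_of (X closure_of S) = {}"

definition meager_in :: "'a topology \<Rightarrow> 'a set \<Rightarrow> bool" where
  "meager_in X S \<longleftrightarrow> (\<exists>N::nat \<Rightarrow> 'a set. (\<forall>k. nowhere_dense_in X (N k)) \<and> S = (\<Union>k. N k))"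

definition comeager_in :: "'a topology \<Rightarrow> 'a set \<Rightarrow> bool" where
  "comeager_in X S \<longleftrightarrow> S \<subseteq> topspace X \<and> meager_in X (topspace X - S)"

section \<open>The space of binary sequences\<close>

text \<open>Sequences are indexed from 0, so position \<open>n\<close> here is position \<open>n + 1\<close> in the indexing by
  positive integers. On \<open>nat \<Rightarrow> bool\<close> the type class topology \<open>euclidean\<close> is the product topology,
  but the type class metric \<open>dist\<close> is not the metric below.\<close>

type_synonym cantor = "nat \<Rightarrow> bool"

definition cantor_dist :: "cantor \<Rightarrow> cantor \<Rightarrow> real" where
  "cantor_dist \<sigma> \<tau> = (if \<sigma> = \<tau> then 0 else 1 / real (Suc (LEAST n. \<sigma> n \<noteq> \<tau> n)))"

lemma cantor_dist_less_iff:
  "cantor_dist \<sigma> \<tau> < 1 / real (Suc n) \<longleftrightarrow> (\<forall>k\<le>n. \<sigma> k = \<tau> k)"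
proof (cases "\<sigma> = \<tau>")
  case False
  define m where "m = (LEAST n. \<sigma> n \<noteq> \<tau> n)"
  have "\<exists>n. \<sigma> n \<noteq> \<tau> n" using False by auto
  then have m: "\<sigma> m \<noteq> \<tau> m" unfolding m_def by (rule LeastI_ex)
  have lt: "\<sigma> k = \<tau> k" if "k < m" for k
    using not_less_Least that unfolding m_def by blast
  have "cantor_dist \<sigma> \<tau> = 1 / real (Suc m)"
    using False unfolding cantor_dist_def m_def by simp
  then have "cantor_dist \<sigma> \<tau> < 1 / real (Suc n) \<longleftrightarrow> n < m"
    by (simp only:) (simp add: divide_simps)
  also have "\<dots> \<longleftrightarrow> (\<forall>k\<le>n. \<sigma> k = \<tau> k)"
    using m lt by (metis linorder_not_less order_le_less_trans)
  finally show ?thesis .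
qed (simp add: cantor_dist_def)

lemma cantor_dist_values: "cantor_dist \<sigma> \<tau> = 0 \<or> (\<exists>n. cantor_dist \<sigma> \<tau> = 1 / real (Suc n))"
  by (auto simp: cantor_dist_def)

lemma cantor_dist_bounds: "0 \<le> cantor_dist \<sigma> \<tau>" "cantor_dist \<sigma> \<tau> \<le> 1"
  by (auto simp: cantor_dist_def)

lemma cantor_dist_commute: "cantor_dist \<sigma> \<tau> = cantor_dist \<tau> \<sigma>"
  by (simp add: cantor_dist_def eq_commute)

lemma cantor_dist_ultrametric:
  "cantor_dist \<rho> \<tau> \<le> max (cantor_dist \<rho> \<sigma>) (cantor_dist \<sigma> \<tau>)"
proof (rule ccontr)
  assume "\<not> ?thesis"
  then have *: "cantor_dist \<rho> \<sigma> < cantor_dist \<rho> \<tau>" "cantor_dist \<sigma> \<tau> < cantor_dist \<rho> \<tau>"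
    by auto
  then obtain n where n: "cantor_dist \<rho> \<tau> = 1 / real (Suc n)"
    using cantor_dist_values[of \<rho> \<tau>] cantor_dist_bounds(1)[of \<rho> \<sigma>] by force
  have "\<forall>k\<le>n. \<rho> k = \<tau> k"
    using * unfolding n cantor_dist_less_iff by simp
  then show False
    using cantor_dist_less_iff[of \<rho> \<tau> n] n by simp
qed

interpretation cantor: Metric_space UNIV cantor_dist
proof
  fix x y z :: cantor
  show "cantor_dist x z \<le> cantor_dist x y + cantor_dist y z"
    using cantor_dist_ultrametric[of x z y] cantor_dist_bounds(1)[of x y]
      cantor_dist_bounds(1)[of y z] by linarith
qed (auto simp: cantor_dist_bounds cantor_dist_commute, auto simp: cantor_dist_def split: if_splits)

lemma mtopology_cantor: "cantor.mtopology = (euclidean :: cantor topology)"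
proof (rule topology_eq[THEN iffD2], intro allI iffI)
  fix U :: "cantor set"
  assume U: "openin cantor.mtopology U"
  have "openin (euclidean :: cantor topology) U"
  proof (subst openin_subopen, intro ballI)
    fix x assume "x \<in> U"
    then obtain r where r: "r > 0" "cantor.mball x r \<subseteq> U"
      using U unfolding cantor.openin_mtopology by blast
    obtain n where n: "1 / real (Suc n) < r"
      using r(1) nat_approx_posE by blast
    define V where "V = {y::cantor. \<forall>k\<in>{..n}. y k \<in> {x k}}"
    have "open V" unfolding V_def
      by (rule product_topology_basis'[where x = "\<lambda>k. k" and U = "\<lambda>k. {x k}"]) (auto intro: open_discrete)
    moreover have "V \<subseteq> U"
    proof
      fix y assume "y \<in> V"
      then have "cantor_dist x y < 1 / real (Suc n)"
        unfolding cantor_dist_less_iff V_def by auto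
      then show "y \<in> U" using n r(2) by (auto simp: subset_iff)
    qed
    moreover have "x \<in> V" by (simp add: V_def)
    ultimately show "\<exists>T. openin euclidean T \<and> x \<in> T \<and> T \<subseteq> U"
      using open_openin by blast
  qed
  then show "openin euclidean U" .
next
  fix U :: "cantor set"
  assume U: "openin euclidean U"
  show "openin cantor.mtopology U"
    unfolding cantor.openin_mtopology
  proof (intro conjI allI impI)
    fix x assume x: "x \<in> U"
    have "openin (product_topology (\<lambda>_. euclidean :: bool topology) UNIV) U"
      using U by (simp add: euclidean_product_topology)
    from product_topology_open_contains_basis[OF this x] obtain X where
      X: "x \<in> (\<Pi>\<^sub>E i\<in>UNIV. X i)" "finite {i. X i \<noteq> topspace (euclidean :: bool topology)}"
         "(\<Pi>\<^sub>E i\<in>UNIV. X i) \<subseteq> U"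
      by blast
    from X(2) obtain n where "\<forall>i\<in>{i. X i \<noteq> topspace (euclidean :: bool topology)}. i \<le> n"
      unfolding finite_nat_set_iff_bounded_le by blast
    then have n: "i \<le> n" if "X i \<noteq> UNIV" for i
      using that by simp
    have "cantor.mball x (1 / real (Suc n)) \<subseteq> U"
    proof
      fix y assume "y \<in> cantor.mball x (1 / real (Suc n))"
      then have eq: "\<forall>k\<le>n. x k = y k"
        by (simp add: cantor_dist_less_iff del: of_nat_Suc)
      have "y i \<in> X i" for i
      proof (cases "X i = UNIV")
        case False
        have "x i \<in> X i" by (rule PiE_mem[OF X(1)]) simp
        then show ?thesis using eq n[OF False] by simp
      qed simp
      then have "y \<in> (\<Pi>\<^sub>E i\<in>UNIV. X i)" by (simp add: PiE_UNIV_domain)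
      then show "y \<in> U" using X(3) by (rule subsetD[rotated])
    qed
    moreover have "0 < 1 / real (Suc n)" by simp
    ultimately show "\<exists>r>0. cantor.mball x r \<subseteq> U" by blast
  qed simp
qed

section \<open>The homeomorphism group\<close>

definition cantor_homeos :: "(cantor \<Rightarrow> cantor) set" where
  "cantor_homeos = {f. homeomorphic_map euclidean euclidean f}"

definition conj_class :: "(cantor \<Rightarrow> cantor) \<Rightarrow> (cantor \<Rightarrow> cantor) set" where
  "conj_class f = {g \<circ> f \<circ> inv g | g. g \<in> cantor_homeos}"

text \<open>The supremum is a maximum, by \<open>homeo_dist_attained\<close>.\<close>

definition homeo_dist :: "(cantor \<Rightarrow> cantor) \<Rightarrow> (cantor \<Rightarrow> cantor) \<Rightarrow> real" where
  "homeo_dist f g = (SUP \<sigma>. cantor_dist (f \<sigma>) (g \<sigma>))"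

lemma homeo_dist_upper: "cantor_dist (f \<sigma>) (g \<sigma>) \<le> homeo_dist f g"
  unfolding homeo_dist_def
  by (rule cSUP_upper) (auto intro!: bdd_aboveI[where M = 1] simp: cantor_dist_bounds)

lemma homeo_dist_attained: "\<exists>\<sigma>. homeo_dist f g = cantor_dist (f \<sigma>) (g \<sigma>)"
proof (cases "f = g")
  case True
  then show ?thesis by (simp add: homeo_dist_def cantor_dist_def)
next
  case False
  define P where "P n \<longleftrightarrow> (\<exists>\<sigma>. f \<sigma> n \<noteq> g \<sigma> n)" for n
  define m where "m = (LEAST n. P n)"
  have "\<exists>n. P n" using False by (auto simp: P_def fun_eq_iff)
  then have "P m" unfolding m_def by (rule LeastI_ex)
  then obtain \<sigma> where \<sigma>: "f \<sigma> m \<noteq> g \<sigma> m" by (auto simp: P_def)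
  have lt: "f \<tau> k = g \<tau> k" if "k < m" for k \<tau>
    using not_less_Least that unfolding m_def P_def by blast
  have up: "cantor_dist (f \<tau>) (g \<tau>) \<le> cantor_dist (f \<sigma>) (g \<sigma>)" for \<tau>
  proof -
    have ge: "\<not> cantor_dist (f \<sigma>) (g \<sigma>) < 1 / real (Suc m)"
      unfolding cantor_dist_less_iff using \<sigma> by blast
    have "cantor_dist (f \<tau>) (g \<tau>) \<le> 1 / real (Suc m)"
    proof (rule ccontr)
      assume "\<not> ?thesis"
      then have gt: "cantor_dist (f \<tau>) (g \<tau>) > 1 / real (Suc m)" by simp
      moreover have "1 / real (Suc m) > 0" by simp
      ultimately have "cantor_dist (f \<tau>) (g \<tau>) \<noteq> 0" by linarith
      then obtain n where n: "cantor_dist (f \<tau>) (g \<tau>) = 1 / real (Suc n)"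
        using cantor_dist_values by blast
      with gt have "1 / real (Suc m) < 1 / real (Suc n)" by simp
      then have "n < m" by (simp add: divide_simps)
      then have "\<forall>k\<le>n. f \<tau> k = g \<tau> k" using lt by auto
      then show False using cantor_dist_less_iff[of "f \<tau>" "g \<tau>" n] n by simp
    qed
    then show ?thesis using ge by linarith
  qed
  have "homeo_dist f g \<le> cantor_dist (f \<sigma>) (g \<sigma>)"
    unfolding homeo_dist_def by (rule cSUP_least) (auto intro: up)
  then have "homeo_dist f g = cantor_dist (f \<sigma>) (g \<sigma>)"
    using homeo_dist_upper[of f \<sigma> g] by linarith
  then show ?thesis by blast
qed

interpretation homeo: Metric_space cantor_homeos homeo_dist
proof
  fix f g k :: "cantor \<Rightarrow> cantor"
  show "0 \<le> homeo_dist f g"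
    using homeo_dist_attained[of f g] cantor_dist_bounds(1) by metis
  show "homeo_dist f g = homeo_dist g f"
    by (simp add: homeo_dist_def cantor_dist_commute)
  show "homeo_dist f g = 0 \<longleftrightarrow> f = g"
  proof
    assume "homeo_dist f g = 0"
    then have "cantor_dist (f \<sigma>) (g \<sigma>) = 0" for \<sigma>
      using homeo_dist_upper[of f \<sigma> g] cantor_dist_bounds(1)[of "f \<sigma>" "g \<sigma>"] by linarith
    then show "f = g" by (intro ext) simp
  qed (simp add: homeo_dist_def cantor_dist_def)
  obtain \<sigma> where "homeo_dist f k = cantor_dist (f \<sigma>) (k \<sigma>)"
    using homeo_dist_attained by blast
  then show "homeo_dist f k \<le> homeo_dist f g + homeo_dist g k"
    using cantor.triangle[of "f \<sigma>" "g \<sigma>" "k \<sigma>"] homeo_dist_upper[of f \<sigma> g]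
      homeo_dist_upper[of g \<sigma> k] by simp
qed

definition comeager_conj_class :: "(cantor \<Rightarrow> cantor) set \<Rightarrow> bool" where
  "comeager_conj_class C \<longleftrightarrow>
     (\<exists>f\<in>cantor_homeos. C = conj_class f) \<and> comeager_in homeo.mtopology C"

end

theory Submission
  imports Defs
begin

text \<open>
  A comeager conjugacy class meets every dense \<open>G\<^sub>\<delta>\<close> set of the homeomorphism group,
  because the group is completely metrizable (\<open>homeo_Baire_category\<close>). The three
  assertions are invariant under conjugation. They therefore follow from a property that is shared
  by the members of a dense \<open>G\<^sub>\<delta>\<close>, is invariant under conjugation, and
  forces the dynamics.

  This property is that for every \<open>m\<close> there is a clopen partition of the space into sets of
  diameter below \<open>1 / m\<close> on which \<open>h\<close> acts as a disjoint union of dumbbells: the cells of each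
  component form a first cycle, a path leading out of it, and a second cycle in which the path
  ends, both cycles having the same length \<open>q \<ge> m\<close> (\<open>dumbbell_resolved\<close>).

  A chain recurrent point can never take the path between the cycles, since there is no way back.
  So it rotates on one cycle and returns to its small cell exactly at the multiples of \<open>q\<close>. Hence
  it is recurrent, and it cannot have a period below \<open>m\<close>. Each cell also contains points that
  do take the path, at some time in the past or future, and these are not chain recurrent; so the
  chain recurrent set has empty interior (\<open>dumbbell_resolved_dynamics\<close>). An isolated point of the
  recurrent set would be periodic, because the set is invariant.

  For fixed \<open>m\<close> the property is open, since the partition is visible in finitely many coordinates.
  It is dense by a splitting construction (\<open>dumbbell_resolved_dense\<close>): each edge of the finite
  graph of transitions of \<open>h\<close> between cylinders lies on the image of a dumbbell, because walks
  in a finite graph can be made eventually periodic in both directions. The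
  cylinders are split among these dumbbells. Nonempty clopen sets being homeomorphic to each
  other, the pieces can be mapped onto each other as the dumbbells prescribe.
\<close>

section \<open>Agreement on initial segments\<close>

definition agree :: "nat \<Rightarrow> cantor \<Rightarrow> cantor \<Rightarrow> bool" where
  "agree n x y \<longleftrightarrow> (\<forall>k<n. x k = y k)"

definition finitely_determined :: "(cantor \<Rightarrow> 'a) \<Rightarrow> bool" where
  "finitely_determined F \<longleftrightarrow> (\<exists>n. \<forall>x y. agree n x y \<longrightarrow> F x = F y)"

text \<open>For self-maps of the compact space of binary sequences this is continuity
  (\<open>continuous_on_cantor_iff\<close>), in uniform form.\<close>

definition coord_continuous :: "(cantor \<Rightarrow> cantor) \<Rightarrow> bool" where
  "coord_continuous f \<longleftrightarrow> (\<forall>n. \<exists>m. \<forall>x y. agree m x y \<longrightarrow> agree n (f x) (f y))"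

lemma agree_refl [simp]: "agree n x x"
  by (simp add: agree_def)

lemma agree_sym: "agree n x y \<Longrightarrow> agree n y x"
  by (simp add: agree_def)

lemma agree_trans: "agree n x y \<Longrightarrow> agree n y z \<Longrightarrow> agree n x z"
  by (simp add: agree_def)

lemma agree_mono: "agree n x y \<Longrightarrow> m \<le> n \<Longrightarrow> agree m x y"
  by (simp add: agree_def)

lemma agree_all_imp_eq: "(\<And>n. agree n x y) \<Longrightarrow> x = y"
  unfolding agree_def by blast

lemma map_upt_eq_iff_agree: "map x [0..<n] = map y [0..<n] \<longleftrightarrow> agree n x y"
  by (auto simp: agree_def)

lemma cantor_dist_less_iff_agree:
  "cantor_dist x y < 1 / real (Suc n) \<longleftrightarrow> agree (Suc n) x y"
  unfolding cantor_dist_less_iff agree_def less_Suc_eq_le ..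

lemma ex_cantor_ball_subset:
  assumes "r > 0"
  obtains n where "\<And>x y. agree n x y \<Longrightarrow> cantor_dist x y < r"
proof -
  obtain n where "1 / real (Suc n) < r"
    using assms nat_approx_posE by blast
  then have "cantor_dist x y < r" if "agree (Suc n) x y" for x y
    using that cantor_dist_less_iff_agree[of x y n] by linarith
  then show ?thesis using that by blast
qed

lemma open_cantor_iff:
  "open U \<longleftrightarrow> (\<forall>x\<in>U. \<exists>n. \<forall>y. agree n x y \<longrightarrow> y \<in> U)" for U :: "cantor set"
proof -
  have "open U \<longleftrightarrow> (\<forall>x\<in>U. \<exists>r>0. cantor.mball x r \<subseteq> U)"
    unfolding open_openin mtopology_cantor[symmetric] cantor.openin_mtopology by blast
  also have "\<dots> \<longleftrightarrow> (\<forall>x\<in>U. \<exists>n. \<forall>y. agree n x y \<longrightarrow> y \<in> U)"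
  proof (intro ball_cong refl iffI)
    fix x assume "\<exists>r>0. cantor.mball x r \<subseteq> U"
    then obtain r where r: "r > 0" "cantor.mball x r \<subseteq> U" by blast
    from ex_cantor_ball_subset[OF r(1)] r(2)
    show "\<exists>n. \<forall>y. agree n x y \<longrightarrow> y \<in> U" by (metis UNIV_I cantor.in_mball subsetD)
  next
    fix x assume "\<exists>n. \<forall>y. agree n x y \<longrightarrow> y \<in> U"
    then obtain n where n: "\<And>y. agree n x y \<Longrightarrow> y \<in> U" by blast
    have "cantor.mball x (1 / real (Suc n)) \<subseteq> U"
    proof
      fix y assume "y \<in> cantor.mball x (1 / real (Suc n))"
      then have "agree (Suc n) x y"
        unfolding cantor.in_mball cantor_dist_less_iff_agree by blast
      then show "y \<in> U" using n agree_mono by (metis le_add2 plus_1_eq_Suc)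
    qed
    moreover have "1 / real (Suc n) > 0" by simp
    ultimately show "\<exists>r>0. cantor.mball x r \<subseteq> U" by blast
  qed
  finally show ?thesis .
qed

lemma open_agree: "open {y. agree n x y}"
  unfolding open_cantor_iff using agree_trans by blast

lemma compact_UNIV_cantor: "compact (UNIV :: cantor set)"
proof -
  have "compact_space (euclidean :: bool topology)"
    by (simp add: compact_space_def finite_imp_compact)
  then have "compact_space (product_topology (\<lambda>_. euclidean :: bool topology) (UNIV :: nat set))"
    by (simp add: compact_space_product_topology)
  then show ?thesis
    by (simp add: euclidean_product_topology compact_space_def)
qed

text \<open>Compactness: finitely many of the cylinders on which \<open>F\<close> is constant cover the space, and the
  longest of their lengths serves for all points.\<close>

lemma locally_constant_imp_finitely_determined:
  assumes "\<And>x. \<exists>n. \<forall>y. agree n x y \<longrightarrow> F x = F y"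
  shows "finitely_determined F"
proof -
  obtain n where n: "\<And>x y. agree (n x) x y \<Longrightarrow> F x = F y"
    using assms by metis
  obtain D where D: "finite D" "UNIV \<subseteq> (\<Union>x\<in>D. {y. agree (n x) x y})"
    by (rule compactE_image[OF compact_UNIV_cantor, of UNIV "\<lambda>x. {y. agree (n x) x y}"])
      (use open_agree in auto)
  have "F x = F y" if xy: "agree (Max (n ` D)) x y" for x y
  proof -
    obtain z where z: "z \<in> D" "agree (n z) z x" using D(2) by blast
    then have "n z \<le> Max (n ` D)" using D(1) by simp
    then have "agree (n z) z y" using xy z(2) agree_mono agree_trans by blast
    then show ?thesis using n z(2) by metis
  qed
  then show ?thesis unfolding finitely_determined_def by blast
qed

lemma continuous_on_cantor_iff:
  "continuous_on UNIV f \<longleftrightarrow> coord_continuous f" for f :: "cantor \<Rightarrow> cantor"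
proof
  assume f: "continuous_on UNIV f"
  show "coord_continuous f"
    unfolding coord_continuous_def
  proof
    fix n
    have "finitely_determined (\<lambda>x. map (f x) [0..<n])"
    proof (rule locally_constant_imp_finitely_determined)
      fix x
      have "open (f -` {z. agree n (f x) z})"
        by (rule open_vimage[OF open_agree f])
      then obtain m where "\<And>y. agree m x y \<Longrightarrow> agree n (f x) (f y)"
        unfolding open_cantor_iff by fastforce
      then show "\<exists>m. \<forall>y. agree m x y \<longrightarrow> map (f x) [0..<n] = map (f y) [0..<n]"
        unfolding map_upt_eq_iff_agree by blast
    qed
    then have "\<exists>m. \<forall>x y. agree m x y \<longrightarrow> map (f x) [0..<n] = map (f y) [0..<n]"
      unfolding finitely_determined_def .
    then show "\<exists>m. \<forall>x y. agree m x y \<longrightarrow> agree n (f x) (f y)"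
      unfolding map_upt_eq_iff_agree .
  qed
next
  assume f: "coord_continuous f"
  have "open (f -` U)" if "open U" for U
    using f that unfolding open_cantor_iff coord_continuous_def by (metis vimage_eq)
  then show "continuous_on UNIV f"
    by (simp add: continuous_on_open_vimage)
qed

lemma cantor_homeos_iff:
  "h \<in> cantor_homeos \<longleftrightarrow> bij h \<and> coord_continuous h \<and> coord_continuous (inv h)"
proof
  assume "h \<in> cantor_homeos"
  then have h: "homeomorphic_map euclidean euclidean h" by (simp add: cantor_homeos_def)
  then obtain k where k: "homeomorphic_maps euclidean euclidean h k"
    using homeomorphic_map_maps by blast
  then have kk: "\<And>x. k (h x) = x" "\<And>x. h (k x) = x" by (auto simp: homeomorphic_maps_def)
  then have "bij h" by (metis bijI')
  moreover from kk have "inv h = k" by (metis inv_equality)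
  ultimately show "bij h \<and> coord_continuous h \<and> coord_continuous (inv h)"
    using k by (auto simp: homeomorphic_maps_def continuous_on_cantor_iff)
next
  assume "bij h \<and> coord_continuous h \<and> coord_continuous (inv h)"
  then have "homeomorphic_maps euclidean euclidean h (inv h)"
    by (auto simp: homeomorphic_maps_def continuous_on_cantor_iff bij_is_inj bij_is_surj surj_f_inv_f)
  then show "h \<in> cantor_homeos" using homeomorphic_map_maps by (auto simp: cantor_homeos_def)
qed

lemma coord_continuous_comp:
  "coord_continuous f \<Longrightarrow> coord_continuous g \<Longrightarrow> coord_continuous (\<lambda>x. f (g x))"
  unfolding coord_continuous_def by meson

lemma finitely_determined_comp:
  "finitely_determined F \<Longrightarrow> coord_continuous f \<Longrightarrow> finitely_determined (\<lambda>x. F (f x))"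
  unfolding coord_continuous_def finitely_determined_def by meson

lemma finitely_determined_apply:
  "finitely_determined F \<Longrightarrow> finitely_determined (\<lambda>x. p (F x))"
  unfolding finitely_determined_def by metis

lemma finitely_determined_Pair:
  assumes "finitely_determined F" "finitely_determined G"
  shows "finitely_determined (\<lambda>x. (F x, G x))"
proof -
  obtain m n where "\<And>x y. agree m x y \<Longrightarrow> F x = F y" "\<And>x y. agree n x y \<Longrightarrow> G x = G y"
    using assms unfolding finitely_determined_def by metis
  then have "\<forall>x y. agree (max m n) x y \<longrightarrow> (F x, G x) = (F y, G y)"
    using agree_mono max.cobounded1 max.cobounded2 by metis
  then show ?thesis unfolding finitely_determined_def by blast
qed

lemma homeo_dist_less_iff:
  "homeo_dist f g < 1 / real (Suc n) \<longleftrightarrow> (\<forall>x. agree (Suc n) (f x) (g x))"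
  using homeo_dist_attained[of f g] homeo_dist_upper[of f _ g] cantor_dist_less_iff_agree
  by (metis order_le_less_trans)

section \<open>Clopen partitions and homeomorphisms\<close>

lemma finitely_determined_finite_range:
  assumes "finitely_determined F"
  shows "finite (range F)"
proof -
  obtain n where n: "\<And>x y. agree n x y \<Longrightarrow> F x = F y"
    using assms unfolding finitely_determined_def by blast
  have "range F \<subseteq> (\<lambda>S. F (\<lambda>k. k \<in> S)) ` Pow {..<n}"
  proof
    fix v assume "v \<in> range F"
    then obtain x where "v = F x" by blast
    also have "\<dots> = F (\<lambda>k. k \<in> {k. k < n \<and> x k})"
      by (rule n) (simp add: agree_def)
    finally show "v \<in> (\<lambda>S. F (\<lambda>k. k \<in> S)) ` Pow {..<n}" by blast
  qed
  then show ?thesis by (rule finite_subset) simp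
qed

lemma coord_continuous_id: "coord_continuous (\<lambda>x. x)"
  unfolding coord_continuous_def by blast

lemma coord_continuous_glue:
  assumes a: "finitely_determined a"
    and F: "\<And>i. i \<in> range a \<Longrightarrow> coord_continuous (F i)"
  shows "coord_continuous (\<lambda>x. F (a x) x)"
  unfolding coord_continuous_def
proof
  fix n
  have "\<forall>i\<in>range a. \<exists>m. \<forall>x y. agree m x y \<longrightarrow> agree n (F i x) (F i y)"
    using F unfolding coord_continuous_def by blast
  then obtain m where
    m: "\<And>i x y. i \<in> range a \<Longrightarrow> agree (m i) x y \<Longrightarrow> agree n (F i x) (F i y)"
    by metis
  obtain l where l: "\<And>x y. agree l x y \<Longrightarrow> a x = a y"
    using a unfolding finitely_determined_def by blast
  define M where "M = max l (Max (m ` range a))"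
  have "agree n (F (a x) x) (F (a y) y)" if xy: "agree M x y" for x y
  proof -
    have "m (a x) \<le> M"
      unfolding M_def using finitely_determined_finite_range[OF a] by (simp add: le_max_iff_disj)
    then have "agree n (F (a x) x) (F (a x) y)"
      using m xy agree_mono by blast
    moreover have "a x = a y"
      using l agree_mono[OF xy] by (simp add: M_def)
    ultimately show ?thesis by simp
  qed
  then show "\<exists>m. \<forall>x y. agree m x y \<longrightarrow> agree n (F (a x) x) (F (a y) y)" by blast
qed

lemma coord_continuous_case_nat:
  assumes "coord_continuous f"
  shows "coord_continuous (\<lambda>x. case_nat b (f x))"
  unfolding coord_continuous_def
proof
  fix n
  obtain m where "\<And>x y. agree m x y \<Longrightarrow> agree n (f x) (f y)"
    using assms unfolding coord_continuous_def by blast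
  then show "\<exists>m. \<forall>x y. agree m x y \<longrightarrow> agree n (case_nat b (f x)) (case_nat b (f y))"
    by (intro exI[of _ m]) (auto simp: agree_def split: nat.split)
qed

lemma coord_continuous_shift: "coord_continuous (\<lambda>x k. x (Suc k))"
  unfolding coord_continuous_def agree_def by (meson Suc_mono)

text \<open>Induction on the number \<open>n\<close> of coordinates that decide membership, splitting
  \<open>A\<close> by the first bit: if both halves are nonempty, the two homeomorphisms are put side by side,
  keeping the first bit; if only one is, the first bit carries no information and is dropped.\<close>

lemma clopen_coord_homeomorphic_UNIV:
  assumes "\<And>x y. agree n x y \<Longrightarrow> x \<in> A \<longleftrightarrow> y \<in> A" and "A \<noteq> {}"
  shows "\<exists>f f'. coord_continuous f \<and> coord_continuous f' \<and>
           (\<forall>x\<in>A. f' (f x) = x) \<and> (\<forall>y. f' y \<in> A \<and> f (f' y) = y)"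
  using assms
proof (induction n arbitrary: A)
  case 0
  then have "A = UNIV" by (auto simp: agree_def)
  then show ?case using coord_continuous_id by blast
next
  case (Suc n)
  define B where "B b = {y. case_nat b y \<in> A}" for b
  have split: "case_nat (x 0) (\<lambda>k. x (Suc k)) = x" for x :: cantor
    by (auto simp: fun_eq_iff split: nat.split)
  then have mem: "x \<in> A \<longleftrightarrow> (\<lambda>k. x (Suc k)) \<in> B (x 0)" for x
    by (simp add: B_def)
  have "y \<in> B b \<longleftrightarrow> z \<in> B b" if "agree n y z" for y z b
    unfolding B_def mem_Collect_eq
    by (rule Suc.prems(1)) (use that in \<open>auto simp: agree_def split: nat.split\<close>)
  then have IH: "\<exists>f f'. coord_continuous f \<and> coord_continuous f' \<and>
      (\<forall>x\<in>B b. f' (f x) = x) \<and> (\<forall>y. f' y \<in> B b \<and> f (f' y) = y)" if "B b \<noteq> {}" for b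
    using Suc.IH[of "B b"] that by blast
  show ?case
  proof (cases "\<forall>b. B b \<noteq> {}")
    case True
    then obtain F F' where F: "\<And>b. coord_continuous (F b)" "\<And>b. coord_continuous (F' b)"
      "\<And>b x. x \<in> B b \<Longrightarrow> F' b (F b x) = x" "\<And>b y. F' b y \<in> B b" "\<And>b y. F b (F' b y) = y"
      using IH by metis
    have cc: "coord_continuous (\<lambda>x. case_nat (x 0) (G (x 0) (\<lambda>k. x (Suc k))))"
      if "\<And>b. coord_continuous (G b)" for G
    proof (rule coord_continuous_glue[where a = "\<lambda>x. x 0"
          and F = "\<lambda>b x. case_nat b (G b (\<lambda>k. x (Suc k)))"])
      show "finitely_determined (\<lambda>x. x 0)"
        unfolding finitely_determined_def by (rule exI[of _ 1]) (simp add: agree_def)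
      show "coord_continuous (\<lambda>x. case_nat b (G b (\<lambda>k. x (Suc k))))" for b
        using coord_continuous_case_nat[OF coord_continuous_comp[OF that coord_continuous_shift]]
        by simp
    qed
    show ?thesis
      by (rule exI[of _ "\<lambda>x. case_nat (x 0) (F (x 0) (\<lambda>k. x (Suc k)))"],
          rule exI[of _ "\<lambda>x. case_nat (x 0) (F' (x 0) (\<lambda>k. x (Suc k)))"])
        (simp add: cc F mem split cong del: nat.case_cong_weak)
  next
    case False
    then obtain c where c: "B c = {}" by blast
    define b where "b = (\<not> c)"
    have head: "x 0 = b" if "x \<in> A" for x
    proof -
      have "B (x 0) \<noteq> {}" using that mem by blast
      then have "x 0 \<noteq> c" using c by (cases "x 0"; cases c) auto
      then show ?thesis unfolding b_def by blast
    qed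
    have "B b \<noteq> {}" using Suc.prems(2) mem head by blast
    then obtain F F' where F: "coord_continuous F" "coord_continuous F'"
      "\<And>x. x \<in> B b \<Longrightarrow> F' (F x) = x" "\<And>y. F' y \<in> B b" "\<And>y. F (F' y) = y"
      using IH by metis
    have "case_nat b (F' (F (\<lambda>k. x (Suc k)))) = x" if "x \<in> A" for x
      using that F(3) mem[of x] head[OF that] split[of x] by simp
    moreover have "case_nat b (F' y) \<in> A" for y
      using F(4) by (simp add: B_def)
    moreover have "coord_continuous (\<lambda>x. F (\<lambda>k. x (Suc k)))"
      using coord_continuous_comp[OF F(1) coord_continuous_shift] by simp
    ultimately show ?thesis
      by (intro exI[of _ "\<lambda>x. F (\<lambda>k. x (Suc k))"] exI[of _ "\<lambda>y. case_nat b (F' y)"])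
        (simp add: F coord_continuous_case_nat)
  qed
qed

text \<open>The fibres of \<open>a\<close> and of \<open>b\<close> over the same label are nonempty clopen sets, hence homeomorphic;
  finitely many such homeomorphisms are glued together.\<close>

lemma ex_homeo_intertwining:
  assumes a: "finitely_determined a" and b: "finitely_determined b" and eq: "range a = range b"
  shows "\<exists>g\<in>cantor_homeos. \<forall>x. b (g x) = a x"
proof -
  have cell: "\<exists>f f'. coord_continuous f \<and> coord_continuous f' \<and>
      (\<forall>x. c x = i \<longrightarrow> f' (f x) = x) \<and> (\<forall>y. c (f' y) = i \<and> f (f' y) = y)"
    if "finitely_determined c" "i \<in> range c" for c :: "cantor \<Rightarrow> 'a" and i
  proof -
    obtain n where "\<And>x y. agree n x y \<Longrightarrow> c x = c y"
      using \<open>finitely_determined c\<close> unfolding finitely_determined_def by blast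
    then show ?thesis
      using clopen_coord_homeomorphic_UNIV[of n "{x. c x = i}"] that(2) by auto
  qed
  obtain f f' where f: "\<And>i. i \<in> range a \<Longrightarrow> coord_continuous (f i)"
    "\<And>i. i \<in> range a \<Longrightarrow> coord_continuous (f' i)"
    "\<And>x. f' (a x) (f (a x) x) = x"
    "\<And>i y. i \<in> range a \<Longrightarrow> a (f' i y) = i"
    "\<And>i y. i \<in> range a \<Longrightarrow> f i (f' i y) = y"
    using cell[OF a] by (metis (no_types, opaque_lifting) rangeI)
  obtain k k' where k: "\<And>i. i \<in> range b \<Longrightarrow> coord_continuous (k i)"
    "\<And>i. i \<in> range b \<Longrightarrow> coord_continuous (k' i)"
    "\<And>x. k' (b x) (k (b x) x) = x"
    "\<And>i y. i \<in> range b \<Longrightarrow> b (k' i y) = i"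
    "\<And>i y. i \<in> range b \<Longrightarrow> k i (k' i y) = y"
    using cell[OF b] by (metis (no_types, opaque_lifting) rangeI)
  define g where "g x = k' (a x) (f (a x) x)" for x
  define g' where "g' y = f' (b y) (k (b y) y)" for y
  have ra: "a x \<in> range b" "b x \<in> range a" for x using eq by blast+
  have bg: "b (g x) = a x" for x unfolding g_def by (simp add: k(4) ra)
  have ag: "a (g' y) = b y" for y unfolding g'_def by (simp add: f(4) ra)
  have "g' (g x) = x" for x
    by (subst g'_def, subst (1 2) bg) (simp add: g_def k(5) f(3) ra)
  moreover have "g (g' y) = y" for y
    by (subst g_def, subst (1 2) ag) (simp add: g'_def f(5) k(3) ra)
  ultimately have inv: "inv g = g'" "bij g"
    by (metis inv_equality, metis bijI')
  have "coord_continuous g" unfolding g_def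
    by (rule coord_continuous_glue[OF a], rule coord_continuous_comp) (simp_all add: f(1) k(2) eq)
  moreover have "coord_continuous g'" unfolding g'_def
    by (rule coord_continuous_glue[OF b], rule coord_continuous_comp) (simp_all add: f(2) k(1) eq)
  ultimately have "g \<in> cantor_homeos" unfolding cantor_homeos_iff using inv by simp
  then show ?thesis using bg by blast
qed

text \<open>Each fibre of \<open>F\<close> is cut into as many nonempty clopen pieces as there are labels above its value.
  The pieces are told apart by the number of ones in a block of coordinates that lies behind those
  that determine \<open>F\<close>: within every cylinder this number takes all values up to the block length.\<close>

lemma ex_finitely_determined_lift:
  assumes F: "finitely_determined F" and I: "finite I" and \<pi>: "\<pi> ` I = range F"
  shows "\<exists>a. finitely_determined a \<and> range a = I \<and> (\<forall>x. \<pi> (a x) = F x)"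
proof -
  obtain n where n: "\<And>x y. agree n x y \<Longrightarrow> F x = F y"
    using F unfolding finitely_determined_def by blast
  define J where "J k = {i \<in> I. \<pi> i = k}" for k
  have "\<exists>e. e ` {..card I} = J k" if "k \<in> range F" for k
  proof -
    have "k \<in> \<pi> ` I" using that \<pi> by simp
    then have J: "finite (J k)" "J k \<noteq> {}" "card (J k) \<le> card I"
      using I by (auto simp: J_def intro: card_mono)
    then obtain e where e: "bij_betw e {0..<card (J k)} (J k)"
      using ex_bij_betw_nat_finite by blast
    have pos: "0 < card (J k)" using J by (simp add: card_gt_0_iff)
    have "e ` {0..<card (J k)} = J k" using e by (simp add: bij_betw_def)
    moreover have "(\<lambda>j. if j < card (J k) then j else 0) ` {..card I} = {0..<card (J k)}"
      using J(3) pos by (auto simp: image_iff intro!: bexI)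
    ultimately have "(e \<circ> (\<lambda>j. if j < card (J k) then j else 0)) ` {..card I} = J k"
      by (simp only: image_comp[symmetric])
    then show ?thesis by blast
  qed
  then obtain e where e: "\<And>k. k \<in> range F \<Longrightarrow> e k ` {..card I} = J k" by metis
  define t where "t x = card {j. j < card I \<and> x (n + j)}" for x :: cantor
  have t_le: "t x \<le> card I" for x
    unfolding t_def using card_mono[of "{..<card I}" "{j. j < card I \<and> x (n + j)}"] by auto
  define a where "a x = e (F x) (t x)" for x
  have aJ: "a x \<in> J (F x)" for x
    using e[of "F x"] t_le by (auto simp: a_def)
  have "I \<subseteq> range a"
  proof
    fix i assume i: "i \<in> I"
    then obtain x where x: "\<pi> i = F x" using \<pi> by blast
    then have "i \<in> e (F x) ` {..card I}" using i e by (simp add: J_def)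
    then obtain r where r: "r \<le> card I" "i = e (F x) r" by auto
    define y where "y k = (if k < n then x k else k < n + r)" for k
    have "{j. j < card I \<and> y (n + j)} = {..<r}" using r(1) by (auto simp: y_def)
    then have "t y = r" by (simp add: t_def)
    moreover have "F y = F x" by (rule n) (simp add: agree_def y_def)
    ultimately show "i \<in> range a" using r(2) by (metis a_def rangeI)
  qed
  moreover have "range a \<subseteq> I" "\<And>x. \<pi> (a x) = F x"
    using aJ by (auto simp: J_def)
  moreover have "finitely_determined a"
    unfolding finitely_determined_def
  proof (intro exI allI impI)
    fix x y assume xy: "agree (n + card I) x y"
    then have "F x = F y" using n agree_mono le_add1 by blast
    moreover have "{j. j < card I \<and> x (n + j)} = {j. j < card I \<and> y (n + j)}"
      using xy by (auto simp: agree_def)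
    ultimately show "a x = a y" by (simp add: a_def t_def)
  qed
  ultimately show ?thesis by blast
qed

lemma funpow_eventually_periodic:
  assumes V: "finite V" "s ` V \<subseteq> V"
  obtains i l :: nat where "l \<ge> 1" "\<And>n k v. v \<in> V \<Longrightarrow> n \<ge> i \<Longrightarrow> (s ^^ (n + k * l)) v = (s ^^ n) v"
proof -
  have inV: "(s ^^ n) v \<in> V" if "v \<in> V" for n v
    using that V(2) by (induction n) auto
  have "range (\<lambda>n. restrict (s ^^ n) V) \<subseteq> V \<rightarrow>\<^sub>E V"
    using inV by (auto simp: restrict_def)
  then have "\<not> inj (\<lambda>n. restrict (s ^^ n) V)"
    using finite_PiE[of V "\<lambda>_. V"] V(1) finite_subset finite_imageD infinite_UNIV_nat by metis
  then obtain i j where ij: "i < j" "restrict (s ^^ i) V = restrict (s ^^ j) V"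
    unfolding inj_on_def by (metis linorder_neqE_nat)
  define l where "l = j - i"
  have step: "(s ^^ (n + l)) v = (s ^^ n) v" if "v \<in> V" "n \<ge> i" for n v
  proof -
    have "n + l = (n - i) + j" "n = (n - i) + i" using ij(1) that(2) by (auto simp: l_def)
    moreover have "(s ^^ j) v = (s ^^ i) v" using ij(2) that(1) by (metis restrict_apply')
    ultimately show ?thesis by (metis funpow_add comp_apply)
  qed
  have "(s ^^ (n + k * l)) v = (s ^^ n) v" if "v \<in> V" "n \<ge> i" for n k v
  proof (induction k)
    case (Suc k)
    have "(s ^^ (n + Suc k * l)) v = (s ^^ ((n + k * l) + l)) v" by (simp add: algebra_simps)
    also have "\<dots> = (s ^^ (n + k * l)) v" by (rule step) (use that in auto)
    finally show ?case using Suc by simp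
  qed simp
  moreover have "l \<ge> 1" using ij(1) by (simp add: l_def)
  ultimately show ?thesis using that by blast
qed

text \<open>In a finite monoid every element has an idempotent power, and arbitrarily high exponents work
  for two elements at once. This yields a single period for all cycles that successor and
  predecessor maps run into.\<close>

lemma ex_common_idempotent_power:
  assumes V: "finite V" "s ` V \<subseteq> V" "p ` V \<subseteq> V"
  obtains q where "q \<ge> m" "q \<ge> 1"
    "\<And>v. v \<in> V \<Longrightarrow> (s ^^ (2 * q)) v = (s ^^ q) v" "\<And>v. v \<in> V \<Longrightarrow> (p ^^ (2 * q)) v = (p ^^ q) v"
proof -
  obtain i l where s: "l \<ge> 1" "\<And>n k v. v \<in> V \<Longrightarrow> n \<ge> i \<Longrightarrow> (s ^^ (n + k * l)) v = (s ^^ n) v"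
    by (rule funpow_eventually_periodic[OF V(1,2)]) (rule that)
  obtain i' l' where p: "l' \<ge> 1" "\<And>n k v. v \<in> V \<Longrightarrow> n \<ge> i' \<Longrightarrow> (p ^^ (n + k * l')) v = (p ^^ n) v"
    by (rule funpow_eventually_periodic[OF V(1,3)]) (rule that)
  define c where "c = m + i + i' + 1"
  \<comment> \<open>A multiple of both periods that exceeds both preperiods.\<close>
  define q where "q = c * (l * l')"
  have "l * l' \<ge> 1" using s(1) p(1) by simp
  then have "c \<le> q" by (simp add: q_def)
  then have ge: "m \<le> q" "1 \<le> q" "i \<le> q" "i' \<le> q" by (auto simp: c_def)
  have double: "2 * q = q + (c * l') * l" "2 * q = q + (c * l) * l'" by (simp_all add: q_def)
  show ?thesis
    using that[of q] ge s(2)[of _ q "c * l'"] p(2)[of _ q "c * l"] unfolding double[symmetric] by blast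
qed

section \<open>Recurrence in terms of initial segments\<close>

lemma chain_recurrent_iff:
  "x \<in> cantor.chain_recurrent_points h \<longleftrightarrow>
     (\<forall>m. \<exists>n\<ge>1. \<exists>p. p 0 = x \<and> p n = x \<and> (\<forall>i<n. agree m (h (p i)) (p (Suc i))))"
    (is "_ \<longleftrightarrow> (\<forall>m. ?chain m)")
proof
  assume x: "x \<in> cantor.chain_recurrent_points h"
  show "\<forall>m. ?chain m"
  proof
    fix m
    have "0 < 1 / real (Suc m)" by simp
    with x obtain n p where n: "n \<ge> 1" "p 0 = x" "p n = x"
      and p: "\<forall>i<n. cantor_dist (h (p i)) (p (Suc i)) < 1 / real (Suc m)"
      unfolding cantor.chain_recurrent_points_def mem_Collect_eq by blast
    have "\<forall>i<n. agree m (h (p i)) (p (Suc i))"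
      using p unfolding cantor_dist_less_iff_agree by (meson agree_mono lessI less_imp_le)
    with n show "?chain m" by blast
  qed
next
  assume chain: "\<forall>m. ?chain m"
  show "x \<in> cantor.chain_recurrent_points h"
    unfolding cantor.chain_recurrent_points_def mem_Collect_eq
  proof (intro conjI allI impI)
    fix \<delta> :: real assume "\<delta> > 0"
    then obtain m where m: "\<And>x y. agree m x y \<Longrightarrow> cantor_dist x y < \<delta>"
      using ex_cantor_ball_subset by blast
    from chain obtain n p where "n \<ge> 1" "p 0 = x" "p n = x" "\<forall>i<n. agree m (h (p i)) (p (Suc i))"
      by blast
    then show "\<exists>n\<ge>1. \<exists>p. p 0 = x \<and> p n = x \<and> (\<forall>i\<le>n. p i \<in> UNIV) \<and>
        (\<forall>i<n. cantor_dist (h (p i)) (p (Suc i)) < \<delta>)"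
      using m by blast
  qed simp
qed

lemma nonwandering_iff:
  "x \<in> cantor.nonwandering_points h \<longleftrightarrow>
     (\<forall>m. \<exists>n\<ge>1. \<exists>y. agree m x y \<and> agree m x ((h ^^ n) y))"
    (is "_ \<longleftrightarrow> (\<forall>m. ?return m)")
proof
  assume x: "x \<in> cantor.nonwandering_points h"
  show "\<forall>m. ?return m"
  proof
    fix m
    have "openin cantor.mtopology {y. agree m x y} \<and> x \<in> {y. agree m x y}"
      using open_agree by (simp add: mtopology_cantor)
    moreover have "\<forall>U. openin cantor.mtopology U \<and> x \<in> U \<longrightarrow> (\<exists>n\<ge>1. (h ^^ n) ` U \<inter> U \<noteq> {})"
      using x by (simp add: cantor.nonwandering_points_def)
    ultimately have "\<exists>n\<ge>1. (h ^^ n) ` {y. agree m x y} \<inter> {y. agree m x y} \<noteq> {}" by blast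
    then show "?return m" by blast
  qed
next
  assume return: "\<forall>m. ?return m"
  have "\<exists>n\<ge>1. (h ^^ n) ` U \<inter> U \<noteq> {}" if "open U" "x \<in> U" for U
  proof -
    have "\<exists>m. \<forall>y. agree m x y \<longrightarrow> y \<in> U"
      using that unfolding open_cantor_iff by (rule bspec)
    then obtain m where m: "\<And>y. agree m x y \<Longrightarrow> y \<in> U" by blast
    obtain n y where "n \<ge> 1" "agree m x y" "agree m x ((h ^^ n) y)"
      using return by blast
    then show ?thesis using m by blast
  qed
  then show "x \<in> cantor.nonwandering_points h"
    by (simp add: cantor.nonwandering_points_def mtopology_cantor)
qed

text \<open>Returns at arbitrarily late times with arbitrarily long agreement can be picked one after the
  other, which gives the convergent subsequence.\<close>

lemma recurrent_iff:
  "x \<in> cantor.recurrent_points h \<longleftrightarrow> (\<forall>m. \<exists>n>m. agree m x ((h ^^ n) x))"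
proof
  assume "x \<in> cantor.recurrent_points h"
  then obtain r where r: "strict_mono r"
    and lim: "limitin euclidean ((\<lambda>n. (h ^^ Suc n) x) \<circ> r) x sequentially"
    unfolding cantor.recurrent_points_def cantor.omega_limit_set_def mtopology_cantor by blast
  show "\<forall>m. \<exists>n>m. agree m x ((h ^^ n) x)"
  proof
    fix m
    have "openin euclidean {y. agree m x y}" using open_agree by simp
    then obtain N where N: "\<And>n. n \<ge> N \<Longrightarrow> agree m x ((h ^^ Suc (r n)) x)"
      using lim unfolding limitin_sequentially comp_def by force
    have "max N m \<le> r (max N m)" using r by (rule seq_suble)
    then have "Suc (r (max N m)) > m" by simp
    moreover have "agree m x ((h ^^ Suc (r (max N m))) x)" by (rule N) simp
    ultimately show "\<exists>n>m. agree m x ((h ^^ n) x)" by blast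
  qed
next
  assume return: "\<forall>m. \<exists>n>m. agree m x ((h ^^ n) x)"
  have late: "\<exists>n>N. agree m x ((h ^^ Suc n) x)" for N m
  proof -
    obtain n where n: "n > max (Suc N) m" "agree (max (Suc N) m) x ((h ^^ n) x)"
      using return by blast
    then have "agree m x ((h ^^ Suc (n - 1)) x)" using agree_mono[OF n(2), of m] by simp
    moreover have "n - 1 > N" using n(1) by linarith
    ultimately show ?thesis by blast
  qed
  have "\<exists>r. \<forall>k. agree k x ((h ^^ Suc (r k)) x) \<and> r k < r (Suc k)"
    by (rule dependent_nat_choice) (use late in blast)+
  then obtain r where r: "\<And>k. agree k x ((h ^^ Suc (r k)) x)" "\<And>k. r k < r (Suc k)" by blast
  have "limitin euclidean ((\<lambda>n. (h ^^ Suc n) x) \<circ> r) x sequentially"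
    unfolding limitin_sequentially comp_def
  proof (intro conjI allI impI)
    fix U assume "openin euclidean U \<and> x \<in> U"
    then obtain m where "\<And>y. agree m x y \<Longrightarrow> y \<in> U"
      unfolding open_openin[symmetric] open_cantor_iff by blast
    then show "\<exists>N. \<forall>n\<ge>N. (h ^^ Suc (r n)) x \<in> U"
      using r(1) agree_mono by blast
  qed simp
  moreover have "strict_mono r" using r(2) by (simp add: strict_mono_Suc_iff)
  ultimately show "x \<in> cantor.recurrent_points h"
    unfolding cantor.recurrent_points_def cantor.omega_limit_set_def mtopology_cantor by blast
qed

lemma recurrent_subset_nonwandering:
  "cantor.recurrent_points h \<subseteq> cantor.nonwandering_points h"
proof
  fix x assume x: "x \<in> cantor.recurrent_points h"
  have "\<exists>n\<ge>1. \<exists>y. agree m x y \<and> agree m x ((h ^^ n) y)" for m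
  proof -
    obtain n where "n > m" "agree m x ((h ^^ n) x)" using x recurrent_iff by blast
    then show ?thesis by (intro exI[of _ n] conjI exI[of _ x]) auto
  qed
  then show "x \<in> cantor.nonwandering_points h" unfolding nonwandering_iff by blast
qed

lemma nonwandering_subset_chain_recurrent:
  assumes "coord_continuous h"
  shows "cantor.nonwandering_points h \<subseteq> cantor.chain_recurrent_points h"
proof
  fix x assume x: "x \<in> cantor.nonwandering_points h"
  show "x \<in> cantor.chain_recurrent_points h"
    unfolding chain_recurrent_iff
  proof
    fix m
    obtain m' where m': "\<And>u v. agree m' u v \<Longrightarrow> agree m (h u) (h v)"
      using assms unfolding coord_continuous_def by blast
    obtain n y where n: "n \<ge> 1" and y: "agree (max m m') x y" "agree (max m m') x ((h ^^ n) y)"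
      using x nonwandering_iff by blast
    define p where "p i = (if i = 0 \<or> i = n then x else (h ^^ i) y)" for i
    have "agree m (h (p i)) (p (Suc i))" if "i < n" for i
    proof -
      have "agree m (h (p i)) ((h ^^ Suc i) y)"
        using that m'[OF agree_mono[OF y(1)]] by (simp add: p_def)
      moreover have "agree m ((h ^^ Suc i) y) (p (Suc i))"
        using agree_sym[OF agree_mono[OF y(2)]] by (auto simp: p_def)
      ultimately show ?thesis by (rule agree_trans)
    qed
    moreover have "p 0 = x" "p n = x" by (simp_all add: p_def)
    ultimately show "\<exists>n\<ge>1. \<exists>p. p 0 = x \<and> p n = x \<and> (\<forall>i<n. agree m (h (p i)) (p (Suc i)))"
      using n by blast
  qed
qed

text \<open>A uniformly continuous map that commutes with \<open>h\<close> sends chains of \<open>h\<close> to chains of \<open>h\<close>. With \<open>h\<close>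
  itself and its inverse for \<open>k\<close>, the chain recurrent set is invariant in both directions.\<close>

lemma chain_recurrent_commuting_image:
  assumes k: "coord_continuous k" and comm: "\<And>y. h (k y) = k (h y)"
    and x: "x \<in> cantor.chain_recurrent_points h"
  shows "k x \<in> cantor.chain_recurrent_points h"
  unfolding chain_recurrent_iff
proof
  fix m
  obtain m' where m': "\<And>u v. agree m' u v \<Longrightarrow> agree m (k u) (k v)"
    using k unfolding coord_continuous_def by blast
  obtain n p where n: "n \<ge> 1" "p 0 = x" "p n = x" "\<forall>i<n. agree m' (h (p i)) (p (Suc i))"
    using x chain_recurrent_iff by blast
  then have "\<forall>i<n. agree m (h (k (p i))) (k (p (Suc i)))"
    using m' by (simp add: comm)
  then show "\<exists>n\<ge>1. \<exists>p. p 0 = k x \<and> p n = k x \<and> (\<forall>i<n. agree m (h (p i)) (p (Suc i)))"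
    using n by (intro exI[of _ n] conjI exI[of _ "k \<circ> p"]) auto
qed

lemma closed_nonwandering_points: "closed (cantor.nonwandering_points h)"
  unfolding closed_def open_cantor_iff
proof
  fix x assume "x \<in> - cantor.nonwandering_points h"
  then obtain m where m: "\<And>n y. n \<ge> 1 \<Longrightarrow> agree m x y \<Longrightarrow> \<not> agree m x ((h ^^ n) y)"
    by (auto simp: nonwandering_iff)
  have "z \<notin> cantor.nonwandering_points h" if "agree m x z" for z
    using m that agree_trans unfolding nonwandering_iff by blast
  then show "\<exists>n. \<forall>y. agree n x y \<longrightarrow> y \<in> - cantor.nonwandering_points h" by blast
qed

text \<open>Otherwise finitely many wandering cylinders would cover the space, and an orbit would visit one
  of them twice.\<close>

lemma nonwandering_points_nonempty: "cantor.nonwandering_points h \<noteq> {}"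
proof
  assume "cantor.nonwandering_points h = {}"
  then have "\<forall>x. \<exists>m. \<forall>n\<ge>1. \<forall>y. agree m x y \<longrightarrow> \<not> agree m x ((h ^^ n) y)"
    using nonwandering_iff[of _ h] by (metis empty_iff)
  then obtain m where m: "\<And>x n y. n \<ge> 1 \<Longrightarrow> agree (m x) x y \<Longrightarrow> \<not> agree (m x) x ((h ^^ n) y)"
    by metis
  obtain D where D: "finite D" "UNIV \<subseteq> (\<Union>x\<in>D. {y. agree (m x) x y})"
    by (rule compactE_image[OF compact_UNIV_cantor, of UNIV "\<lambda>x. {y. agree (m x) x y}"])
      (use open_agree in auto)
  fix x :: cantor
  have "\<forall>k. \<exists>z\<in>D. agree (m z) z ((h ^^ k) x)" using D(2) by blast
  then obtain z where z: "\<And>k. z k \<in> D" "\<And>k. agree (m (z k)) (z k) ((h ^^ k) x)" by metis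
  have "finite (range z)" using z(1) D(1) by (meson finite_subset image_subsetI)
  then have "\<not> inj z" using finite_imageD infinite_UNIV_nat by blast
  then obtain i j where ij: "i < j" "z i = z j"
    unfolding inj_on_def by (metis linorder_neqE_nat)
  have "(h ^^ (j - i)) ((h ^^ i) x) = (h ^^ j) x"
    using ij(1) by (metis comp_apply funpow_add le_add_diff_inverse2 less_imp_le)
  moreover have "1 \<le> j - i" using ij(1) by linarith
  ultimately show False using m[of "j - i" "z i" "(h ^^ i) x"] z(2)[of i] z(2)[of j] ij by auto
qed

section \<open>Dumbbells and the dynamics that they force\<close>

text \<open>A dumbbell is the directed graph on the vertices \<open>0, \<dots>, T\<close> that consists of two cycles of the
  same length \<open>q\<close>, through the first \<open>q\<close> and through the last \<open>q\<close> vertices, and a path from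
  the first cycle to the second.\<close>

definition dumbbell_arrows :: "nat \<Rightarrow> nat \<Rightarrow> (nat \<times> nat) set" where
  "dumbbell_arrows q T = {(i, Suc i) | i. i < T} \<union> {(q - 1, 0), (T, Suc T - q)}"

text \<open>The fibres of \<open>\<lambda>x. (c x, l x)\<close> are the cells of a finite clopen partition; \<open>c\<close> names a component
  and \<open>l\<close> a vertex of its dumbbell. The final clause excludes components that merely rotate on
  a cycle; without it the chain recurrent set could have interior points.\<close>

definition dumbbell_labelling ::
    "nat \<Rightarrow> nat \<Rightarrow> (cantor \<Rightarrow> cantor) \<Rightarrow> (cantor \<Rightarrow> nat) \<Rightarrow> (cantor \<Rightarrow> nat) \<Rightarrow> bool" where
  "dumbbell_labelling q T h c l \<longleftrightarrow>
     0 < q \<and> 2 * q \<le> T \<and> finitely_determined (\<lambda>x. (c x, l x)) \<and>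
     (\<forall>x. c (h x) = c x \<and> (l x, l (h x)) \<in> dumbbell_arrows q T) \<and>
     (\<forall>x. \<exists>y. c y = c x \<and> l y = q - 1 \<and> l (h y) = q)"

text \<open>The same parameter bounds the cycle length from below and the diameter of the cells from above;
  the former excludes periodic points, the latter makes returns to a cell close returns.\<close>

definition dumbbell_resolved :: "nat \<Rightarrow> (cantor \<Rightarrow> cantor) \<Rightarrow> bool" where
  "dumbbell_resolved m h \<longleftrightarrow>
     (\<exists>q T c l. m \<le> q \<and> dumbbell_labelling q T h c l \<and>
        (\<forall>x y. c x = c y \<and> l x = l y \<longrightarrow> agree m x y))"

text \<open>A height function for the dumbbell: it is constant on each cycle and increases strictly along the
  path between them, so no arrow decreases it.\<close>

definition stage :: "nat \<Rightarrow> nat \<Rightarrow> nat \<Rightarrow> nat" where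
  "stage q T i = (if i < q then 0 else min i (Suc T - q))"

lemma stage_mono:
  assumes "0 < q" "2 * q \<le> T" "(i, j) \<in> dumbbell_arrows q T"
  shows "stage q T i \<le> stage q T j"
  using assms by (auto simp: dumbbell_arrows_def stage_def)

text \<open>The arrows that keep the stage are those of the two cycles. The number \<open>b\<close> is the first vertex of
  the cycle, \<open>r\<close> the position on it.\<close>

lemma stage_eq_imp_cycle:
  assumes "0 < q" "2 * q \<le> T" "(i, j) \<in> dumbbell_arrows q T" "stage q T i = stage q T j"
  obtains b r where "b \<in> {0, Suc T - q}" "r < q" "i = b + r" "j = b + Suc r mod q"
proof -
  consider "i < q" | "Suc T - q \<le> i" "i \<le> T"
    using assms by (auto simp: dumbbell_arrows_def stage_def split: if_splits)
  then show ?thesis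
  proof cases
    case 1
    have "j = Suc i mod q"
      using assms 1 by (auto simp: dumbbell_arrows_def stage_def mod_Suc split: if_splits)
    then show ?thesis using 1 by (intro that[of 0 i]) auto
  next
    case 2
    define r where "r = i - (Suc T - q)"
    have i: "i = (Suc T - q) + r" using 2 by (simp add: r_def)
    have r: "r < q" using 2 assms(2) by (simp add: r_def)
    have "j = (Suc T - q) + Suc r mod q"
      using assms(1-3) i r by (auto simp: dumbbell_arrows_def mod_Suc)
    then show ?thesis using i r by (intro that[of "Suc T - q" r]) auto
  qed
qed

lemma constant_stage_imp_rotation:
  assumes q: "0 < q" "2 * q \<le> T"
    and arrow: "\<And>k. (u k, u (Suc k)) \<in> dumbbell_arrows q T"
    and stage: "\<And>k. stage q T (u k) = stage q T (u (Suc k))"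
  obtains b r where "b \<in> {0, Suc T - q}" "r < q" "\<And>k. u k = b + (r + k) mod q"
proof -
  obtain b r where br: "b \<in> {0, Suc T - q}" "r < q" "u 0 = b + r"
    by (rule stage_eq_imp_cycle[OF q arrow[of 0] stage[of 0]]) (rule that)
  have "u k = b + (r + k) mod q" for k
  proof (induction k)
    case 0
    then show ?case using br by simp
  next
    case (Suc k)
    obtain b' r' where br': "b' \<in> {0, Suc T - q}" "r' < q" "u k = b' + r'" "u (Suc k) = b' + Suc r' mod q"
      by (rule stage_eq_imp_cycle[OF q arrow[of k] stage[of k]]) (rule that)
    define s where "s = (r + k) mod q"
    have "s < q" "b + s = b' + r'" "q < Suc T - q"
      using q Suc br'(3) by (simp_all add: s_def)
    then have "b' = b" "r' = s"
      using br(1) br'(1,2) by auto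
    then show ?case using br'(4) by (simp add: s_def mod_Suc_eq)
  qed
  then show ?thesis using br that by blast
qed

context
  fixes q T h c l
  assumes D: "dumbbell_labelling q T h c l"
begin

lemma dumbbell_bounds: "0 < q" "2 * q \<le> T"
  using D by (auto simp: dumbbell_labelling_def)

lemma dumbbell_component: "c ((h ^^ k) x) = c x"
  using D by (induction k) (auto simp: dumbbell_labelling_def)

lemma dumbbell_step: "(l x, l (h x)) \<in> dumbbell_arrows q T"
  using D by (auto simp: dumbbell_labelling_def)

text \<open>Along a chain whose errors are invisible to the labelling the stage cannot decrease. Since the
  chain returns to its starting point, the stage is constant on it, in particular on its first step.\<close>

lemma chain_recurrent_stage:
  assumes "x \<in> cantor.chain_recurrent_points h"
  shows "stage q T (l x) = stage q T (l (h x))"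
proof -
  obtain m where m: "\<And>u v. agree m u v \<Longrightarrow> l u = l v"
    using D unfolding dumbbell_labelling_def finitely_determined_def by blast
  obtain n p where n: "n \<ge> 1" "p 0 = x" "p n = x" and p: "\<And>i. i < n \<Longrightarrow> agree m (h (p i)) (p (Suc i))"
    using assms unfolding chain_recurrent_iff by blast
  have lp: "l (h (p i)) = l (p (Suc i))" if "i < n" for i
    using m p that by blast
  have up: "stage q T (l (h x)) \<le> stage q T (l (p i))" if "1 \<le> i" "i \<le> n" for i
    using that
  proof (induction i rule: dec_induct)
    case base
    then show ?case using lp[of 0] n by simp
  next
    case (step i)
    have "stage q T (l (p i)) \<le> stage q T (l (p (Suc i)))"
      using stage_mono[OF dumbbell_bounds dumbbell_step[of "p i"]] lp[of i] step.prems by simp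
    then show ?case using step by simp
  qed
  show ?thesis
    using up[of n] n stage_mono[OF dumbbell_bounds dumbbell_step[of x]] by simp
qed

lemma chain_recurrent_rotation:
  assumes h: "coord_continuous h" and x: "x \<in> cantor.chain_recurrent_points h"
  obtains b r where "b \<in> {0, Suc T - q}" "r < q" "\<And>k. l ((h ^^ k) x) = b + (r + k) mod q"
proof -
  have cr: "(h ^^ k) x \<in> cantor.chain_recurrent_points h" for k
    using x by (induction k) (auto intro: chain_recurrent_commuting_image[OF h])
  show ?thesis
    using constant_stage_imp_rotation[OF dumbbell_bounds, of "\<lambda>k. l ((h ^^ k) x)"]
      dumbbell_step chain_recurrent_stage[OF cr] that by auto
qed

lemma exit_orbit_left:
  assumes h: "bij h" and y: "l y = q - 1"
  shows "j < q \<Longrightarrow> l ((inv h ^^ j) y) = q - 1 - j"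
proof (induction j)
  case 0
  then show ?case using y by simp
next
  case (Suc j)
  define z where "z = (inv h ^^ Suc j) y"
  have "h z = (inv h ^^ j) y"
    using h by (simp add: z_def bij_is_surj surj_f_inv_f)
  then have "(l z, q - 1 - j) \<in> dumbbell_arrows q T"
    using dumbbell_step[of z] Suc by simp
  then have "l z = q - 1 - Suc j"
    using Suc.prems dumbbell_bounds by (auto simp: dumbbell_arrows_def)
  then show ?case by (simp add: z_def)
qed

lemma exit_orbit_right:
  assumes y: "l (h y) = q"
  shows "q + j \<le> T \<Longrightarrow> l ((h ^^ Suc j) y) = q + j"
proof (induction j)
  case 0
  then show ?case using y by simp
next
  case (Suc j)
  then have "(q + j, l ((h ^^ Suc (Suc j)) y)) \<in> dumbbell_arrows q T"
    using dumbbell_step[of "(h ^^ Suc j) y"] by simp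
  then show ?case
    using Suc.prems dumbbell_bounds by (auto simp: dumbbell_arrows_def)
qed

text \<open>The orbit of a point that leaves the first cycle passes through every vertex of its component:
  backwards once around the first cycle, forwards along the path and once around the second.\<close>

lemma exit_orbit_meets_cell:
  assumes h: "bij h" and y: "c y = c x" "l y = q - 1" "l (h y) = q"
  obtains k where "c ((h ^^ k) y) = c x" "l ((h ^^ k) y) = l x"
  | k where "c ((inv h ^^ k) y) = c x" "l ((inv h ^^ k) y) = l x"
proof (cases "l x < q")
  case True
  define j where "j = q - 1 - l x"
  have "l ((inv h ^^ j) y) = l x"
    using exit_orbit_left[OF h y(2), of j] True by (simp add: j_def)
  moreover have "c ((inv h ^^ j) y) = c x"
    using dumbbell_component[of j "(inv h ^^ j) y"] y(1) h
    by (simp add: fn_o_inv_fn_is_id[OF h, THEN fun_cong, simplified])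
  ultimately show ?thesis using that(2) by blast
next
  case False
  define j where "j = l x - q"
  have "l x \<le> T" using dumbbell_step[of x] dumbbell_bounds by (auto simp: dumbbell_arrows_def)
  then have "l ((h ^^ Suc j) y) = l x"
    using exit_orbit_right[OF y(3), of j] False by (simp add: j_def)
  moreover have "c ((h ^^ Suc j) y) = c x" using dumbbell_component y(1) by metis
  ultimately show ?thesis using that(1) by blast
qed

end

text \<open>Chain recurrent points rotate along cycles of length \<open>q\<close>. They return to their cell after \<open>q\<close>
  steps and not earlier: with small cells this is recurrence, with large \<open>q\<close> it rules out periodic
  points. Every cell meets the orbit of a point that leaves a cycle, which is not chain recurrent;
  with small cells the chain recurrent set has empty interior.\<close>

lemma dumbbell_resolved_dynamics:
  assumes h: "h \<in> cantor_homeos" and res: "\<And>m. dumbbell_resolved m h"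
  shows "cantor.periodic_points h = {}"
    and "cantor.chain_recurrent_points h \<subseteq> cantor.recurrent_points h"
    and "interior (cantor.chain_recurrent_points h) = {}"
proof -
  let ?CR = "cantor.chain_recurrent_points h"
  have h': "bij h" "coord_continuous h" "coord_continuous (inv h)"
    using h cantor_homeos_iff by auto
  have per: "(h ^^ n) x \<noteq> x" if "n \<ge> 1" for n x
  proof
    assume eq: "(h ^^ n) x = x"
    have x: "x \<in> ?CR" unfolding chain_recurrent_iff
      by (intro allI exI[of _ n] conjI exI[of _ "\<lambda>i. (h ^^ i) x"]) (use eq that in auto)
    obtain q T c l where q: "Suc n \<le> q" and D: "dumbbell_labelling q T h c l"
      using res unfolding dumbbell_resolved_def by blast
    obtain b r where r: "r < q" and rot: "\<And>k. l ((h ^^ k) x) = b + (r + k) mod q"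
      by (rule chain_recurrent_rotation[OF D h'(2) x]) (rule that)
    have "(r + n) mod q = r" using rot[of n] rot[of 0] eq r by simp
    moreover have "(r + n) mod q = (if r + n < q then r + n else r + n - q)"
      using q r by (simp add: mod_if)
    ultimately show False using q that r by (auto split: if_splits)
  qed
  then show "cantor.periodic_points h = {}"
    by (auto simp: cantor.periodic_points_def)
  show "?CR \<subseteq> cantor.recurrent_points h"
  proof
    fix x assume x: "x \<in> ?CR"
    have "\<exists>n>m. agree m x ((h ^^ n) x)" for m
    proof -
      obtain q T c l where q: "Suc m \<le> q" and D: "dumbbell_labelling q T h c l"
        and mesh: "\<And>x y. c x = c y \<Longrightarrow> l x = l y \<Longrightarrow> agree (Suc m) x y"
        using res unfolding dumbbell_resolved_def by blast
      obtain b r where rot: "\<And>k. l ((h ^^ k) x) = b + (r + k) mod q"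
        by (rule chain_recurrent_rotation[OF D h'(2) x]) (rule that)
      have "l x = l ((h ^^ q) x)" using rot[of 0] rot[of q] by simp
      then have "agree (Suc m) x ((h ^^ q) x)"
        using mesh dumbbell_component[OF D] by metis
      then have "agree m x ((h ^^ q) x)" by (rule agree_mono) simp
      then show ?thesis using q by (intro exI[of _ q]) simp
    qed
    then show "x \<in> cantor.recurrent_points h" unfolding recurrent_iff by blast
  qed
  show "interior ?CR = {}"
  proof (rule ccontr)
    assume "interior ?CR \<noteq> {}"
    then obtain x where "x \<in> interior ?CR" by blast
    then obtain m where m: "\<And>y. agree m x y \<Longrightarrow> y \<in> interior ?CR"
      using open_interior[of ?CR] unfolding open_cantor_iff by blast
    obtain q T c l where D: "dumbbell_labelling q T h c l"
      and mesh: "\<And>x y. c x = c y \<Longrightarrow> l x = l y \<Longrightarrow> agree m x y"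
      using res unfolding dumbbell_resolved_def by blast
    have cell: "z \<in> ?CR" if "c z = c x" "l z = l x" for z
      using m mesh[of x z] that interior_subset by force
    obtain y where y: "c y = c x" "l y = q - 1" "l (h y) = q"
      using D unfolding dumbbell_labelling_def by blast
    have fwd: "h u \<in> ?CR" and bwd: "inv h u \<in> ?CR" if "u \<in> ?CR" for u
      using chain_recurrent_commuting_image[OF h'(2) _ that]
        chain_recurrent_commuting_image[OF h'(3) _ that] h'(1)
      by (auto simp: bij_is_inj bij_is_surj surj_f_inv_f)
    have fwds: "(h ^^ k) u \<in> ?CR" and bwds: "(inv h ^^ k) u \<in> ?CR" if "u \<in> ?CR" for u k
      using that by (induction k) (auto simp: fwd bwd)
    have "y \<in> ?CR"
    proof (rule exit_orbit_meets_cell[OF D h'(1) y])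
      fix k assume "c ((h ^^ k) y) = c x" "l ((h ^^ k) y) = l x"
      then have "(inv h ^^ k) ((h ^^ k) y) \<in> ?CR" using cell bwds by blast
      then show ?thesis by (simp add: inv_fn_o_fn_is_id[OF h'(1), THEN fun_cong, simplified])
    next
      fix k assume "c ((inv h ^^ k) y) = c x" "l ((inv h ^^ k) y) = l x"
      then have "(h ^^ k) ((inv h ^^ k) y) \<in> ?CR" using cell fwds by blast
      then show ?thesis by (simp add: fn_o_inv_fn_is_id[OF h'(1), THEN fun_cong, simplified])
    qed
    then have "stage q T (q - 1) = stage q T q"
      using chain_recurrent_stage[OF D] y by metis
    then show False using dumbbell_bounds[OF D] by (auto simp: stage_def)
  qed
qed

section \<open>Density of dumbbell dynamics\<close>

lemma finite_dumbbell_arrows: "finite (dumbbell_arrows q T)"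
proof -
  have "{(i, Suc i) | i. i < T} = (\<lambda>i. (i, Suc i)) ` {..<T}" by auto
  then show ?thesis by (simp add: dumbbell_arrows_def)
qed

lemma dumbbell_arrows_sources_targets:
  assumes "0 < q" "2 * q \<le> T"
  shows "fst ` dumbbell_arrows q T = {..T}" "snd ` dumbbell_arrows q T = {..T}"
proof -
  have "fst ` {(i, Suc i) | i. i < T} = {..<T}" by force
  then show "fst ` dumbbell_arrows q T = {..T}"
    using assms by (auto simp: dumbbell_arrows_def image_Un)
  have "snd ` {(i, Suc i) | i. i < T} = Suc ` {..<T}" by force
  then show "snd ` dumbbell_arrows q T = {..T}"
    using assms by (auto simp: dumbbell_arrows_def image_Un lessThan_Suc_atMost[symmetric] 
        image_Suc_lessThan lessThan_Suc_eq_insert_0)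
qed

text \<open>Let every vertex of a finite graph \<open>G\<close> have a successor and a predecessor. From any
  edge, iterating a choice \<open>s\<close> of successors forwards and a choice \<open>p\<close> of predecessors backwards
  runs into cycles, so the edge lies on the image \<open>W\<close> of a dumbbell. A common idempotent exponent \<open>q\<close>
  of \<open>s\<close> and \<open>p\<close> lets the same dumbbell serve for all edges.\<close>

lemma ex_dumbbell_walks:
  assumes V: "finite V" and G: "G \<subseteq> V \<times> V"
    and out: "\<And>v. v \<in> V \<Longrightarrow> \<exists>w. (v, w) \<in> G" and into: "\<And>v. v \<in> V \<Longrightarrow> \<exists>u. (u, v) \<in> G"
  obtains q T W where "m \<le> q" "0 < q" "2 * q \<le> T"
    "\<And>e i j. e \<in> G \<Longrightarrow> (i, j) \<in> dumbbell_arrows q T \<Longrightarrow> (W e i, W e j) \<in> G"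
    "\<And>e. e \<in> G \<Longrightarrow> \<exists>(i, j)\<in>dumbbell_arrows q T. (W e i, W e j) = e"
proof -
  obtain s where s: "\<And>v. v \<in> V \<Longrightarrow> (v, s v) \<in> G" using out by metis
  obtain p where p: "\<And>v. v \<in> V \<Longrightarrow> (p v, v) \<in> G" using into by metis
  have sp: "s ` V \<subseteq> V" "p ` V \<subseteq> V" using s p G by auto
  obtain q where q: "q \<ge> m" "q \<ge> 1"
    and idem: "\<And>v. v \<in> V \<Longrightarrow> (s ^^ (2 * q)) v = (s ^^ q) v"
      "\<And>v. v \<in> V \<Longrightarrow> (p ^^ (2 * q)) v = (p ^^ q) v"
    by (rule ex_common_idempotent_power[OF V sp, of m]) (rule that)
  \<comment> \<open>The edge \<open>e\<close> is the arrow from \<open>2 * q\<close> to \<open>2 * q + 1\<close>. The \<open>2 * q\<close> steps on its left and the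
      \<open>2 * q - 1\<close> on its right suffice for the walk to become periodic and to run once around.\<close>
  define W where "W e i = (if i \<le> 2 * q then (p ^^ (2 * q - i)) (fst e)
      else (s ^^ (i - Suc (2 * q))) (snd e))" for e i
  have inV: "(s ^^ n) v \<in> V" "(p ^^ n) v \<in> V" if "v \<in> V" for n v
    using that sp by (induction n) auto
  have walk: "(W e i, W e (Suc i)) \<in> G" if e: "e \<in> G" for e i
  proof -
    have eV: "fst e \<in> V" "snd e \<in> V" using e G by auto
    consider "i < 2 * q" | "i = 2 * q" | "i > 2 * q" by linarith
    then show ?thesis
    proof cases
      case 1
      then have "2 * q - i = Suc (2 * q - Suc i)" by simp
      then show ?thesis
        using 1 p[OF inV(2)[OF eV(1), of "2 * q - Suc i"]] by (simp add: W_def)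
    next
      case 2
      then show ?thesis using e by (simp add: W_def)
    next
      case 3
      then have "Suc i - Suc (2 * q) = Suc (i - Suc (2 * q))" by simp
      then show ?thesis
        using 3 s[OF inV(1)[OF eV(2), of "i - Suc (2 * q)"]] by (simp add: W_def)
    qed
  qed
  have left: "W e 0 = W e q" and right: "W e (Suc (4 * q)) = W e (Suc (4 * q) - q)"
    if e: "e \<in> G" for e
  proof -
    have eV: "fst e \<in> V" "snd e \<in> V" using e G by auto
    show "W e 0 = W e q" using idem(2)[OF eV(1)] by (simp add: W_def mult_2)
    have "Suc (4 * q) - q - Suc (2 * q) = q" "Suc (4 * q) - Suc (2 * q) = 2 * q"
      "\<not> Suc (4 * q) - q \<le> 2 * q" using q(2) by simp_all
    then show "W e (Suc (4 * q)) = W e (Suc (4 * q) - q)"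
      using idem(1)[OF eV(2)] by (simp add: W_def)
  qed
  have arrow: "(W e i, W e j) \<in> G" if "e \<in> G" "(i, j) \<in> dumbbell_arrows q (4 * q)" for e i j
  proof -
    have "j = Suc i \<or> Suc i = q \<and> j = 0 \<or> i = 4 * q \<and> j = Suc (4 * q) - q"
      using that(2) q(2) by (auto simp: dumbbell_arrows_def)
    then consider "j = Suc i" | "Suc i = q" "j = 0" | "i = 4 * q" "j = Suc (4 * q) - q"
      by blast
    then show ?thesis
    proof cases
      case 2
      then show ?thesis using walk[OF that(1), of i] left[OF that(1)] by simp
    next
      case 3
      then show ?thesis using walk[OF that(1), of i] right[OF that(1)] by metis
    qed (simp add: walk that)
  qed
  have centre: "\<exists>(i, j)\<in>dumbbell_arrows q (4 * q). (W e i, W e j) = e" for e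
    by (rule bexI[of _ "(2 * q, Suc (2 * q))"]) (use q(2) in \<open>auto simp: W_def dumbbell_arrows_def\<close>)
  show ?thesis
    using that[of q "4 * q" W] q arrow centre by auto
qed

text \<open>Let \<open>G\<close> be the graph of transitions of \<open>h\<close> between cylinders of length \<open>M\<close>, and map one dumbbell
  into \<open>G\<close> over each edge. The set of points that make a given transition is cut into pieces, one for
  each dumbbell arrow above it; this is the labelling \<open>a\<close>. The pieces that start at a dumbbell vertex
  form its cell. Each cell is cut a second time, now into one piece for each arrow that ends
  there; this is the labelling \<open>b\<close>. A homeomorphism \<open>g\<close> that carries the pieces of \<open>a\<close> to those of
  \<open>b\<close> follows the arrows of the dumbbells. Above \<open>G\<close> it makes the same transitions as \<open>h\<close>, so the
  images under \<open>g\<close> and \<open>h\<close> lie in the same cylinder.\<close>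

lemma dumbbell_resolved_dense:
  assumes h: "h \<in> cantor_homeos"
  obtains g where "g \<in> cantor_homeos" "dumbbell_resolved m g" "\<And>x. agree N (g x) (h x)"
proof -
  have h': "bij h" "coord_continuous h" using h cantor_homeos_iff by auto
  define M where "M = max N m"
  define pre where "pre x = map x [0..<M]" for x :: cantor
  define F where "F x = (pre x, pre (h x))" for x
  have pre_agree: "pre x = pre y \<longleftrightarrow> agree M x y" for x y
    unfolding pre_def by (rule map_upt_eq_iff_agree)
  have fpre: "finitely_determined pre"
    unfolding finitely_determined_def pre_agree by blast
  have fF: "finitely_determined F"
    unfolding F_def
    by (rule finitely_determined_Pair[OF fpre finitely_determined_comp[OF fpre h'(2)]])
  have "\<exists>w. (v, w) \<in> range F" if "v \<in> range pre" for v
    using that by (auto simp: F_def)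
  moreover have "\<exists>u. (u, v) \<in> range F" if "v \<in> range pre" for v
  proof -
    from that obtain x where "v = pre x" by blast
    then have "F (inv h x) = (pre (inv h x), v)"
      using h'(1) by (simp add: F_def bij_is_surj surj_f_inv_f)
    then show ?thesis by (metis rangeI)
  qed
  moreover have "range F \<subseteq> range pre \<times> range pre" by (auto simp: F_def)
  moreover have "finite (range pre)" using fpre by (rule finitely_determined_finite_range)
  ultimately obtain q T W where q: "m \<le> q" "0 < q" "2 * q \<le> T"
    and arrow: "\<And>e i j. e \<in> range F \<Longrightarrow> (i, j) \<in> dumbbell_arrows q T \<Longrightarrow> (W e i, W e j) \<in> range F"
    and hit: "\<And>e. e \<in> range F \<Longrightarrow> \<exists>(i, j)\<in>dumbbell_arrows q T. (W e i, W e j) = e"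
    using ex_dumbbell_walks[of "range pre" "range F" m] by metis
  define I where "I = range F \<times> dumbbell_arrows q T"
  define \<phi> where "\<phi> = (\<lambda>(e, i, j). (W e i, W e j))"
  define src where "src = (\<lambda>(e :: bool list \<times> bool list, i :: nat, j :: nat). (e, i))"
  define tgt where "tgt = (\<lambda>(e :: bool list \<times> bool list, i :: nat, j :: nat). (e, j))"
  have fin: "finite I"
    using finitely_determined_finite_range[OF fF] finite_dumbbell_arrows by (simp add: I_def)
  have "\<phi> ` I = range F"
  proof
    show "\<phi> ` I \<subseteq> range F"
    proof (rule image_subsetI)
      fix t assume t: "t \<in> I"
      obtain e i j where "t = (e, i, j)" by (rule prod_cases3)
      then show "\<phi> t \<in> range F" using t arrow[of e i j] by (simp add: I_def \<phi>_def)
    qed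
    show "range F \<subseteq> \<phi> ` I"
    proof
      fix e assume e: "e \<in> range F"
      then obtain i j where "(i, j) \<in> dumbbell_arrows q T" "(W e i, W e j) = e" using hit by blast
      then show "e \<in> \<phi> ` I" using e by (intro image_eqI[of _ _ "(e, i, j)"]) (auto simp: I_def \<phi>_def)
    qed
  qed
  then obtain a where a: "finitely_determined a" "range a = I" "\<And>x. \<phi> (a x) = F x"
    using ex_finitely_determined_lift[OF fF fin] by blast
  have "src ` I = range F \<times> fst ` dumbbell_arrows q T" "tgt ` I = range F \<times> snd ` dumbbell_arrows q T"
    unfolding I_def src_def tgt_def by (force simp: image_iff)+
  then have "tgt ` I = src ` range a"
    using dumbbell_arrows_sources_targets[OF q(2,3)] a(2) by simp
  then have "tgt ` I = range (\<lambda>x. src (a x))" by (simp add: image_image)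
  then obtain b where b: "finitely_determined b" "range b = I" "\<And>x. tgt (b x) = src (a x)"
    using ex_finitely_determined_lift[OF finitely_determined_apply[OF a(1)] fin] by blast
  obtain g where g: "g \<in> cantor_homeos" "\<And>x. b (g x) = a x"
    using ex_homeo_intertwining[OF a(1) b(1)] a(2) b(2) by auto
  have next_cell: "src (a (g x)) = tgt (a x)" for x
    using b(3)[of "g x"] g(2) by simp
  have pre_src: "pre x = (case src (a x) of (e, i) \<Rightarrow> W e i)" 
    and pre_tgt: "pre (h x) = (case tgt (a x) of (e, i) \<Rightarrow> W e i)" for x
    using a(3)[of x] by (auto simp: \<phi>_def F_def src_def tgt_def split: prod.splits)
  have close: "agree M (g x) (h x)" for x
    using pre_src[of "g x"] pre_tgt[of x] next_cell[of x] pre_agree by metis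
  define c where "c x = to_nat (fst (a x))" for x
  define l where "l x = fst (snd (a x))" for x
  have a_next: "fst (a (g x)) = fst (a x)" "l (g x) = snd (snd (a x))" for x
    using next_cell[of x] by (auto simp: src_def tgt_def l_def split: prod.splits)
  have aI: "a x \<in> I" for x using a(2) by blast
  have "dumbbell_labelling q T g c l"
    unfolding dumbbell_labelling_def
  proof (intro conjI allI)
    show "finitely_determined (\<lambda>x. (c x, l x))"
      using finitely_determined_apply[OF a(1), of "\<lambda>t. (to_nat (fst t), fst (snd t))"]
      by (simp add: c_def l_def)
    show "c (g x) = c x" for x by (simp add: c_def a_next)
    show "(l x, l (g x)) \<in> dumbbell_arrows q T" for x
      using aI[of x] unfolding a_next(2) unfolding l_def by (auto simp: I_def)
    show "\<exists>y. c y = c x \<and> l y = q - 1 \<and> l (g y) = q" for x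
    proof -
      have "(fst (a x), q - 1, q) \<in> I"
        using aI[of x] q by (auto simp: I_def dumbbell_arrows_def)
      then obtain y where "a y = (fst (a x), q - 1, q)" using a(2) by (metis imageE)
      then show ?thesis by (intro exI[of _ y]) (simp add: c_def a_next, simp add: l_def)
    qed
  qed (use q in auto)
  moreover have "agree m x y" if "c x = c y" "l x = l y" for x y
  proof -
    have "src (a x) = src (a y)"
      using that by (auto simp: c_def l_def src_def split: prod.splits)
    then have "agree M x y" using pre_src[of x] pre_src[of y] pre_agree by metis
    then show ?thesis by (rule agree_mono) (simp add: M_def)
  qed
  ultimately have "dumbbell_resolved m g" unfolding dumbbell_resolved_def using q(1) by blast
  moreover have "agree N (g x) (h x)" for x
    using close by (rule agree_mono) (simp add: M_def)
  ultimately show ?thesis using that g(1) by blast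
qed

text \<open>The labelling depends on finitely many coordinates, so a map that agrees with \<open>h\<close> on these admits
  the same labelling.\<close>

lemma dumbbell_resolved_open:
  assumes "dumbbell_resolved m h"
  obtains n where "\<And>g. (\<And>x. agree n (h x) (g x)) \<Longrightarrow> dumbbell_resolved m g"
proof -
  obtain q T c l where q: "m \<le> q" and D: "dumbbell_labelling q T h c l"
    and mesh: "\<forall>x y. c x = c y \<and> l x = l y \<longrightarrow> agree m x y"
    using assms unfolding dumbbell_resolved_def by blast
  obtain n where n: "\<And>x y. agree n x y \<Longrightarrow> (c x, l x) = (c y, l y)"
    using D unfolding dumbbell_labelling_def finitely_determined_def by blast
  have "dumbbell_resolved m g" if g: "\<And>x. agree n (h x) (g x)" for g
  proof -
    have same: "c (g x) = c (h x)" "l (g x) = l (h x)" for x using n[OF g[of x]] by auto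
    have "dumbbell_labelling q T g c l"
      using D unfolding dumbbell_labelling_def same .
    then show ?thesis unfolding dumbbell_resolved_def using q mesh by blast
  qed
  then show ?thesis using that by blast
qed

text \<open>The labelling of \<open>f\<close> is transported by \<open>g\<close>. Cells may grow in the process, hence a finer
  labelling is taken to begin with.\<close>

lemma dumbbell_resolved_conjugate:
  assumes g: "g \<in> cantor_homeos" and f: "\<And>m. dumbbell_resolved m f"
  shows "dumbbell_resolved m (g \<circ> f \<circ> inv g)"
proof -
  have g': "bij g" "coord_continuous g" "coord_continuous (inv g)"
    using g cantor_homeos_iff by auto
  have gi: "inv g (g x) = x" "g (inv g x) = x" for x
    using g'(1) by (auto simp: bij_is_inj bij_is_surj surj_f_inv_f)
  obtain M where M: "\<And>x y. agree M x y \<Longrightarrow> agree m (g x) (g y)"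
    using g'(2) unfolding coord_continuous_def by blast
  obtain q T c l where q: "max M m \<le> q" and D: "dumbbell_labelling q T f c l"
    and mesh: "\<And>x y. c x = c y \<Longrightarrow> l x = l y \<Longrightarrow> agree (max M m) x y"
    using f unfolding dumbbell_resolved_def by blast
  have "dumbbell_labelling q T (g \<circ> f \<circ> inv g) (\<lambda>x. c (inv g x)) (\<lambda>x. l (inv g x))"
    unfolding dumbbell_labelling_def
  proof (intro conjI allI)
    show "finitely_determined (\<lambda>x. (c (inv g x), l (inv g x)))"
      using D g'(3) finitely_determined_comp[of "\<lambda>x. (c x, l x)" "inv g"]
      by (simp add: dumbbell_labelling_def)
    show "\<exists>y. c (inv g y) = c (inv g x) \<and> l (inv g y) = q - 1 \<and> l (inv g ((g \<circ> f \<circ> inv g) y)) = q"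
      for x
    proof -
      obtain y where "c y = c (inv g x)" "l y = q - 1" "l (f y) = q"
        using D unfolding dumbbell_labelling_def by blast
      then show ?thesis by (intro exI[of _ "g y"]) (simp add: gi)
    qed
  qed (use D in \<open>auto simp: dumbbell_labelling_def gi\<close>)
  moreover have "agree m x y" if "c (inv g x) = c (inv g y)" "l (inv g x) = l (inv g y)" for x y
    using M[OF agree_mono[OF mesh[OF that]]] by (simp add: gi)
  ultimately show ?thesis unfolding dumbbell_resolved_def using q by (meson max.boundedE)
qed

section \<open>Baire category in the homeomorphism group\<close>

lemma inv_cantor_homeos: "f \<in> cantor_homeos \<Longrightarrow> inv f \<in> cantor_homeos"
  unfolding cantor_homeos_iff by (simp add: bij_imp_bij_inv inv_inv_eq)

lemma openin_homeo_iff: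
  "openin homeo.mtopology U \<longleftrightarrow> U \<subseteq> cantor_homeos \<and>
     (\<forall>f\<in>U. \<exists>n. \<forall>g\<in>cantor_homeos. (\<forall>x. agree n (f x) (g x)) \<longrightarrow> g \<in> U)"
proof -
  have eqv: "(\<exists>r>0. homeo.mball f r \<subseteq> U) \<longleftrightarrow>
      (\<exists>n. \<forall>g\<in>cantor_homeos. (\<forall>x. agree n (f x) (g x)) \<longrightarrow> g \<in> U)"
    if f: "f \<in> cantor_homeos" for f
  proof
    assume "\<exists>r>0. homeo.mball f r \<subseteq> U"
    then obtain r where r: "r > 0" "homeo.mball f r \<subseteq> U" by blast
    obtain n where n: "1 / real (Suc n) < r" using r(1) nat_approx_posE by blast
    have "g \<in> U" if "g \<in> cantor_homeos" "\<forall>x. agree (Suc n) (f x) (g x)" for g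
    proof -
      have "homeo_dist f g < 1 / real (Suc n)" using that(2) unfolding homeo_dist_less_iff .
      then show ?thesis using n r(2) f that(1) by auto
    qed
    then show "\<exists>n. \<forall>g\<in>cantor_homeos. (\<forall>x. agree n (f x) (g x)) \<longrightarrow> g \<in> U" by blast
  next
    assume "\<exists>n. \<forall>g\<in>cantor_homeos. (\<forall>x. agree n (f x) (g x)) \<longrightarrow> g \<in> U"
    then obtain n where n: "\<And>g. g \<in> cantor_homeos \<Longrightarrow> \<forall>x. agree n (f x) (g x) \<Longrightarrow> g \<in> U"
      by blast
    have "homeo.mball f (1 / real (Suc n)) \<subseteq> U"
    proof
      fix g assume "g \<in> homeo.mball f (1 / real (Suc n))"
      then have "g \<in> cantor_homeos" "\<forall>x. agree (Suc n) (f x) (g x)"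
        unfolding homeo.in_mball homeo_dist_less_iff by blast+
      then show "g \<in> U" using n agree_mono le_SucI order_refl by metis
    qed
    moreover have "1 / real (Suc n) > 0" by simp
    ultimately show "\<exists>r>0. homeo.mball f r \<subseteq> U" by blast
  qed
  show ?thesis
    unfolding homeo.openin_mtopology Ball_def[of U]
    by (intro conj_cong all_cong1 imp_cong refl) (rule eqv, blast)
qed

text \<open>The uniform distance on the homeomorphism group is not complete, since a uniform limit of
  homeomorphisms may fail to be injective. Adding the distance of the inverses repairs this and
  does not change the topology.\<close>

definition two_sided_dist :: "(cantor \<Rightarrow> cantor) \<Rightarrow> (cantor \<Rightarrow> cantor) \<Rightarrow> real" where
  "two_sided_dist f g = max (homeo_dist f g) (homeo_dist (inv f) (inv g))"

interpretation two_sided: Metric_space cantor_homeos two_sided_dist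
proof
  fix f g :: "cantor \<Rightarrow> cantor"
  show "0 \<le> two_sided_dist f g" by (simp add: two_sided_dist_def le_max_iff_disj)
  show "two_sided_dist f g = two_sided_dist g f"
    by (simp add: two_sided_dist_def homeo.commute)
next
  fix f g assume fg: "f \<in> cantor_homeos" "g \<in> cantor_homeos"
  have "homeo_dist f g = 0 \<longleftrightarrow> f = g" using fg by simp
  moreover have "0 \<le> homeo_dist f g" "0 \<le> homeo_dist (inv f) (inv g)" by simp_all
  moreover have "homeo_dist (inv f) (inv g) = 0" if "f = g"
    using that inv_cantor_homeos[OF fg(2)] by simp
  ultimately show "two_sided_dist f g = 0 \<longleftrightarrow> f = g"
    unfolding two_sided_dist_def by (metis max.absorb2 max.cobounded1 order_antisym)
next
  fix f g k assume fgk: "f \<in> cantor_homeos" "g \<in> cantor_homeos" "k \<in> cantor_homeos"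
  then show "two_sided_dist f k \<le> two_sided_dist f g + two_sided_dist g k"
    using homeo.triangle[of f g k] homeo.triangle[of "inv f" "inv g" "inv k"] inv_cantor_homeos
    by (auto simp: two_sided_dist_def max_def)
qed

lemma two_sided_dist_less_iff:
  "two_sided_dist f g < 1 / real (Suc n) \<longleftrightarrow>
     (\<forall>x. agree (Suc n) (f x) (g x)) \<and> (\<forall>x. agree (Suc n) (inv f x) (inv g x))"
  unfolding two_sided_dist_def max_less_iff_conj homeo_dist_less_iff ..

text \<open>Inversion is continuous: if \<open>g\<close> is close to \<open>f\<close>, then \<open>f (inv g x)\<close> is close to \<open>x\<close>, and the uniform
  continuity of \<open>inv f\<close> applies.\<close>

lemma homeo_inverse_close:
  assumes "f \<in> cantor_homeos"
  obtains m where
    "\<And>g. g \<in> cantor_homeos \<Longrightarrow> \<forall>x. agree m (f x) (g x) \<Longrightarrow> \<forall>x. agree n (inv f x) (inv g x)"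
proof -
  have f: "bij f" "coord_continuous (inv f)" using assms cantor_homeos_iff by auto
  obtain m where m: "\<And>u v. agree m u v \<Longrightarrow> agree n (inv f u) (inv f v)"
    using f(2) unfolding coord_continuous_def by blast
  have "agree n (inv f y) (inv g y)"
    if "g \<in> cantor_homeos" "\<forall>x. agree m (f x) (g x)" for g y
  proof -
    have "bij g" using that(1) cantor_homeos_iff by blast
    then have "g (inv g y) = y" by (simp add: bij_is_surj surj_f_inv_f)
    then have "agree m (f (inv g y)) y" using that(2) by metis
    then have "agree n (inv f (f (inv g y))) (inv f y)" by (rule m)
    then show ?thesis using f(1) by (simp add: bij_is_inj agree_sym)
  qed
  then show ?thesis using that by blast
qed

lemma mtopology_two_sided: "two_sided.mtopology = homeo.mtopology"
proof (rule topology_eq[THEN iffD2], intro allI iffI)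
  fix U assume U: "openin two_sided.mtopology U"
  show "openin homeo.mtopology U"
    unfolding openin_homeo_iff
  proof (intro conjI ballI)
    show "U \<subseteq> cantor_homeos" using U unfolding two_sided.openin_mtopology by blast
    fix f assume f: "f \<in> U"
    with U obtain r where r: "r > 0" "two_sided.mball f r \<subseteq> U" and fh: "f \<in> cantor_homeos"
      unfolding two_sided.openin_mtopology by blast
    obtain n where n: "1 / real (Suc n) < r" using r(1) nat_approx_posE by blast
    obtain m where m: "\<And>g. g \<in> cantor_homeos \<Longrightarrow> \<forall>x. agree m (f x) (g x) \<Longrightarrow>
        \<forall>x. agree (Suc n) (inv f x) (inv g x)"
      by (rule homeo_inverse_close[OF fh]) (rule that)
    have "g \<in> U" if g: "g \<in> cantor_homeos" "\<forall>x. agree (max m (Suc n)) (f x) (g x)" for g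
    proof -
      have "\<forall>x. agree m (f x) (g x)" "\<forall>x. agree (Suc n) (f x) (g x)"
        using g(2) agree_mono max.cobounded1 max.cobounded2 by metis+
      then have "two_sided_dist f g < 1 / real (Suc n)"
        using m[OF g(1)] unfolding two_sided_dist_less_iff by blast
      then show ?thesis using r(2) n fh g(1) by auto
    qed
    then show "\<exists>n. \<forall>g\<in>cantor_homeos. (\<forall>x. agree n (f x) (g x)) \<longrightarrow> g \<in> U" by blast
  qed
next
  fix U assume U: "openin homeo.mtopology U"
  show "openin two_sided.mtopology U"
    unfolding two_sided.openin_mtopology
  proof (intro conjI allI impI)
    show "U \<subseteq> cantor_homeos" using U unfolding homeo.openin_mtopology by blast
    fix f assume "f \<in> U"
    with U obtain r where r: "r > 0" "homeo.mball f r \<subseteq> U"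
      unfolding homeo.openin_mtopology by blast
    have "two_sided.mball f r \<subseteq> homeo.mball f r"
      by (auto simp: two_sided_dist_def)
    then show "\<exists>r>0. two_sided.mball f r \<subseteq> U" using r by blast
  qed
qed

lemma uniformly_Cauchy_limit:
  assumes cont: "\<And>i. coord_continuous (s i)"
    and Cauchy: "\<And>n. \<exists>N. \<forall>i\<ge>N. \<forall>j\<ge>N. \<forall>x. agree n (s i x) (s j x)"
  obtains f where "coord_continuous f" "\<And>n. \<exists>N::nat. \<forall>i\<ge>N. \<forall>x. agree n (s i x) (f x)"
proof -
  obtain N where N: "\<And>n i j x. i \<ge> N n \<Longrightarrow> j \<ge> N n \<Longrightarrow> agree n (s i x) (s j x)"
    using Cauchy by metis
  define f where "f x k = s (N (Suc k)) x k" for x k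
  have lim: "agree n (s i x) (f x)" if "i \<ge> N n" for n i x
    unfolding agree_def
  proof (intro allI impI)
    fix k assume "k < n"
    define j where "j = max i (N (Suc k))"
    have "s i x k = s j x k"
      using N[of n i j x] that \<open>k < n\<close> by (simp add: j_def agree_def)
    also have "\<dots> = f x k"
      using N[of "Suc k" j "N (Suc k)" x] by (simp add: j_def agree_def f_def)
    finally show "s i x k = f x k" .
  qed
  have "coord_continuous f"
    unfolding coord_continuous_def
  proof
    fix n
    obtain m where m: "\<And>x y. agree m x y \<Longrightarrow> agree n (s (N n) x) (s (N n) y)"
      using cont unfolding coord_continuous_def by blast
    have "agree n (f x) (f y)" if "agree m x y" for x y
    proof -
      have "agree n (s (N n) x) (f x)" "agree n (s (N n) y) (f y)" by (simp_all add: lim)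
      then show ?thesis using m[OF that] by (meson agree_sym agree_trans)
    qed
    then show "\<exists>m. \<forall>x y. agree m x y \<longrightarrow> agree n (f x) (f y)" by blast
  qed
  then show ?thesis using that lim by blast
qed

lemma uniform_limit_right_inverse:
  assumes cont: "coord_continuous f"
    and f: "\<And>n. \<exists>N::nat. \<forall>i\<ge>N. \<forall>x. agree n (s i x) (f x)"
    and k: "\<And>n. \<exists>N::nat. \<forall>i\<ge>N. \<forall>x. agree n (t i x) (k x)"
    and st: "\<And>i y. s i (t i y) = y"
  shows "f (k y) = y"
proof (rule agree_all_imp_eq)
  fix n
  obtain m where m: "\<And>u v. agree m u v \<Longrightarrow> agree n (f u) (f v)"
    using cont unfolding coord_continuous_def by blast
  obtain N1 where N1: "\<And>i x. i \<ge> N1 \<Longrightarrow> agree n (s i x) (f x)" using f by blast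
  obtain N2 where N2: "\<And>i x. i \<ge> N2 \<Longrightarrow> agree m (t i x) (k x)" using k by blast
  define i where "i = max N1 N2"
  have "agree n (f (t i y)) (f (k y))" by (rule m, rule N2) (simp add: i_def)
  moreover have "agree n (s i (t i y)) (f (t i y))" by (rule N1) (simp add: i_def)
  ultimately show "agree n (f (k y)) y" unfolding st by (metis agree_sym agree_trans)
qed

text \<open>A Cauchy sequence and the sequence of its inverses both converge uniformly to continuous maps, and
  these are inverse to each other.\<close>

lemma mcomplete_two_sided: "two_sided.mcomplete"
  unfolding two_sided.mcomplete_def
proof (intro allI impI)
  fix s assume s: "two_sided.MCauchy s"
  then have sh: "s i \<in> cantor_homeos" for i unfolding two_sided.MCauchy_def by blast
  have C: "\<exists>N. \<forall>i\<ge>N. \<forall>j\<ge>N. (\<forall>x. agree n (s i x) (s j x)) \<and>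
      (\<forall>x. agree n (inv (s i) x) (inv (s j) x))" for n
  proof -
    have "0 < 1 / real (Suc n)" by simp
    then obtain N where "\<forall>i j. N \<le> i \<longrightarrow> N \<le> j \<longrightarrow> two_sided_dist (s i) (s j) < 1 / real (Suc n)"
      using s unfolding two_sided.MCauchy_def by blast
    then show ?thesis unfolding two_sided_dist_less_iff by (meson agree_mono le_SucI order_refl)
  qed
  have cc: "coord_continuous (s i)" "coord_continuous (inv (s i))" "bij (s i)" for i
    using sh cantor_homeos_iff by auto
  have C1: "\<exists>N. \<forall>i\<ge>N. \<forall>j\<ge>N. \<forall>x. agree n (s i x) (s j x)"
    and C2: "\<exists>N. \<forall>i\<ge>N. \<forall>j\<ge>N. \<forall>x. agree n (inv (s i) x) (inv (s j) x)" for n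
    using C[of n] by meson+
  obtain f where f: "coord_continuous f" "\<And>n. \<exists>N::nat. \<forall>i\<ge>N. \<forall>x. agree n (s i x) (f x)"
    by (rule uniformly_Cauchy_limit[OF cc(1) C1]) (rule that)
  obtain k where k: "coord_continuous k" "\<And>n. \<exists>N::nat. \<forall>i\<ge>N. \<forall>x. agree n (inv (s i) x) (k x)"
    by (rule uniformly_Cauchy_limit[OF cc(2) C2]) (rule that)
  have fk: "f (k y) = y" for y
    by (rule uniform_limit_right_inverse[OF f(1), of s "\<lambda>i. inv (s i)"])
      (use f(2) k(2) cc(3) in \<open>auto simp: bij_is_surj surj_f_inv_f\<close>)
  have kf: "k (f y) = y" for y
    by (rule uniform_limit_right_inverse[OF k(1), of "\<lambda>i. inv (s i)" s])
      (use f(2) k(2) cc(3) in \<open>auto simp: bij_is_inj\<close>)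
  have inv: "inv f = k" "bij f" using fk kf by (metis inv_equality, metis bijI')
  then have fh: "f \<in> cantor_homeos" unfolding cantor_homeos_iff using f(1) k(1) by simp
  have "\<exists>N. \<forall>i\<ge>N. two_sided_dist (s i) f < \<epsilon>" if "\<epsilon> > 0" for \<epsilon>
  proof -
    from nat_approx_posE[OF that] obtain n where n: "1 / real (Suc n) < \<epsilon>" .
    from f(2) obtain N1 where "\<forall>i\<ge>N1. \<forall>x. agree (Suc n) (s i x) (f x)" ..
    moreover from k(2) obtain N2 where
      "\<forall>i\<ge>N2. \<forall>x. agree (Suc n) (inv (s i) x) (inv f x)"
      unfolding inv(1) ..
    ultimately have "\<forall>i\<ge>max N1 N2. two_sided_dist (s i) f < 1 / real (Suc n)"
      unfolding two_sided_dist_less_iff by simp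
    then show ?thesis using n by (meson less_trans)
  qed
  then have "limitin two_sided.mtopology s f sequentially"
    unfolding two_sided.limitin_metric eventually_sequentially using fh sh by blast
  then show "\<exists>f. limitin two_sided.mtopology s f sequentially" by blast
qed

lemma homeo_Baire_category:
  assumes "countable \<G>"
    and "\<And>T. T \<in> \<G> \<Longrightarrow> openin homeo.mtopology T \<and> homeo.mtopology closure_of T = cantor_homeos"
  shows "homeo.mtopology closure_of \<Inter>\<G> = cantor_homeos"
  using two_sided.metric_Baire_category[OF mcomplete_two_sided assms(1)] assms(2)
  unfolding mtopology_two_sided .

text \<open>The complements of the closures of countably many nowhere dense sets and the sets of \<open>m\<close>-resolved
  homeomorphisms are open and dense, so they have a common element.\<close>

lemma ex_dumbbell_resolved_in_comeager:
  assumes "comeager_in homeo.mtopology C"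
  obtains f where "f \<in> C" "f \<in> cantor_homeos" "\<And>m. dumbbell_resolved m f"
proof -
  obtain N :: "nat \<Rightarrow> (cantor \<Rightarrow> cantor) set" where nd: "\<And>k. nowhere_dense_in homeo.mtopology (N k)"
    and N: "cantor_homeos - C = (\<Union>k. N k)"
    using assms unfolding comeager_in_def meager_in_def by auto
  define U where "U k = cantor_homeos - homeo.mtopology closure_of (N k)" for k
  define G where "G m = {f \<in> cantor_homeos. dumbbell_resolved m f}" for m
  have U: "openin homeo.mtopology (U k) \<and> homeo.mtopology closure_of (U k) = cantor_homeos" for k
  proof
    show "openin homeo.mtopology (U k)"
      unfolding U_def using openin_diff[OF openin_topspace closedin_closure_of]
      by (metis homeo.topspace_mtopology)
    show "homeo.mtopology closure_of (U k) = cantor_homeos"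
      using nd[of k] unfolding nowhere_dense_in_def U_def interior_of_eq_empty_complement by simp
  qed
  have G: "openin homeo.mtopology (G m) \<and> homeo.mtopology closure_of (G m) = cantor_homeos" for m
  proof
    show "openin homeo.mtopology (G m)"
      unfolding openin_homeo_iff
    proof (intro conjI ballI)
      fix f assume "f \<in> G m"
      then have "dumbbell_resolved m f" by (simp add: G_def)
      then obtain n where "\<And>g. (\<And>x. agree n (f x) (g x)) \<Longrightarrow> dumbbell_resolved m g"
        using dumbbell_resolved_open by blast
      then show "\<exists>n. \<forall>g\<in>cantor_homeos. (\<forall>x. agree n (f x) (g x)) \<longrightarrow> g \<in> G m"
        by (auto simp: G_def)
    qed (auto simp: G_def)
    have "G m \<inter> T \<noteq> {}" if "openin homeo.mtopology T" "T \<noteq> {}" for T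
    proof -
      from that obtain f where f: "f \<in> T" "f \<in> cantor_homeos"
        unfolding openin_homeo_iff by blast
      from that(1) f(1) obtain n where
        n: "\<And>g. g \<in> cantor_homeos \<Longrightarrow> \<forall>x. agree n (f x) (g x) \<Longrightarrow> g \<in> T"
        unfolding openin_homeo_iff by blast
      obtain g where "g \<in> cantor_homeos" "dumbbell_resolved m g" "\<And>x. agree n (g x) (f x)"
        by (rule dumbbell_resolved_dense[OF f(2), of m n]) (rule that)
      then have "g \<in> G m" "g \<in> T" using n agree_sym by (auto simp: G_def)
      then show ?thesis by blast
    qed
    then show "homeo.mtopology closure_of (G m) = cantor_homeos"
      using dense_intersects_open[of homeo.mtopology "G m"] by simp
  qed
  have "homeo.mtopology closure_of \<Inter>(range U \<union> range G) = cantor_homeos"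
    by (rule homeo_Baire_category) (use U G in auto)
  moreover have "id \<in> cantor_homeos" by (simp add: cantor_homeos_def)
  ultimately have "\<Inter>(range U \<union> range G) \<noteq> {}" by (metis closure_of_empty empty_iff)
  then obtain f where "f \<in> \<Inter>(range U \<union> range G)" by (meson ex_in_conv)
  then have f: "f \<in> U k" "f \<in> G m" for k m by auto
  have fh: "f \<in> cantor_homeos" using f(2) by (simp add: G_def)
  have "f \<notin> N k" for k
    using f(1)[of k] nd[of k] closure_of_subset[of "N k" homeo.mtopology]
    unfolding nowhere_dense_in_def U_def by blast
  then have "f \<in> C" using N fh by blast
  then show ?thesis using that fh f(2) by (simp add: G_def)
qed

text \<open>One member of the class is resolved at all scales, and this property passes to its conjugates:
  first to the representative \<open>f\<close>, from there to \<open>h\<close>.\<close>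

lemma comeager_conj_class_dumbbell_resolved:
  assumes "comeager_conj_class C" "h \<in> C"
  shows "h \<in> cantor_homeos" "dumbbell_resolved m h"
proof -
  obtain f where C: "C = conj_class f" and com: "comeager_in homeo.mtopology C"
    using assms(1) unfolding comeager_conj_class_def by blast
  show "h \<in> cantor_homeos"
    using com assms(2) by (auto simp: comeager_in_def)
  obtain h0 where h0: "h0 \<in> C" "\<And>m. dumbbell_resolved m h0"
    by (rule ex_dumbbell_resolved_in_comeager[OF com]) (rule that)
  obtain k where k: "k \<in> cantor_homeos" "h0 = k \<circ> f \<circ> inv k"
    using h0(1) by (auto simp: C conj_class_def)
  obtain g where g: "g \<in> cantor_homeos" "h = g \<circ> f \<circ> inv g"
    using assms(2) by (auto simp: C conj_class_def)
  have "bij k" using k(1) cantor_homeos_iff by blast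
  then have "inv k \<circ> h0 \<circ> inv (inv k) = f"
    by (simp add: k(2) inv_inv_eq fun_eq_iff bij_is_inj)
  then have "dumbbell_resolved m f" for m
    using dumbbell_resolved_conjugate[OF inv_cantor_homeos[OF k(1)] h0(2)] by metis
  then show "dumbbell_resolved m h"
    using dumbbell_resolved_conjugate[OF g(1)] g(2) by blast
qed

section \<open>Dynamics of the comeager conjugacy class\<close>

lemma cantor_dim_le_0: "(euclidean :: cantor topology) dim_le 0"
  unfolding dimension_le_0_neighbourhood_base_of_clopen neighbourhood_base_of_def
    neighbourhood_base_at_def
proof (intro ballI allI impI)
  fix x :: cantor and W
  assume "openin euclidean W \<and> x \<in> W"
  then obtain n where n: "\<And>y. agree n x y \<Longrightarrow> y \<in> W"
    unfolding open_openin[symmetric] open_cantor_iff by blast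
  let ?B = "{y. agree n x y}"
  have "closed ?B"
    unfolding closed_def open_cantor_iff using agree_sym agree_trans by blast
  then show "\<exists>U V. openin euclidean U \<and> (closedin euclidean V \<and> openin euclidean V) \<and>
      x \<in> U \<and> U \<subseteq> V \<and> V \<subseteq> W"
    using n open_agree[of n x] by (intro exI[of _ ?B]) auto
qed

theorem theorem4p5:
  fixes C :: "(cantor \<Rightarrow> cantor) set" and h :: "cantor \<Rightarrow> cantor"
  assumes "comeager_conj_class C" and "h \<in> C"
  shows "cantor.periodic_points h = {} \<and>
    (cantor.recurrent_points h = cantor.nonwandering_points h \<and>
     cantor.nonwandering_points h = cantor.chain_recurrent_points h) \<and>
    (Cantor_set_in euclidean (cantor.recurrent_points h) \<and>
     interior (cantor.recurrent_points h) = {})"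
proof -
  let ?R = "cantor.recurrent_points h" and ?\<Omega> = "cantor.nonwandering_points h"
    and ?CR = "cantor.chain_recurrent_points h"
  have h: "h \<in> cantor_homeos" and res: "\<And>m. dumbbell_resolved m h"
    using comeager_conj_class_dumbbell_resolved[OF assms] by auto
  have cont: "coord_continuous h" using h cantor_homeos_iff by blast
  note dyn = dumbbell_resolved_dynamics[OF h res]
  have eq: "?R = ?\<Omega>" "?\<Omega> = ?CR"
    using recurrent_subset_nonwandering[of h] nonwandering_subset_chain_recurrent[OF cont] dyn(2)
    by auto
  have "compact ?R"
    using closed_Int_compact[OF closed_nonwandering_points[of h] compact_UNIV_cantor] eq(1) by simp
  then have "compact_space (subtopology euclidean ?R)"
    by (simp add: compact_space_subtopology)
  moreover have "metrizable_space (subtopology euclidean ?R)"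
    using cantor.metrizable_space_mtopology
    unfolding mtopology_cantor by (rule metrizable_space_subtopology)
  moreover have "subtopology euclidean ?R dim_le 0"
    by (rule dimension_le_subtopology[OF cantor_dim_le_0])
  moreover have "\<not> openin (subtopology euclidean ?R) {x}" if x: "x \<in> ?R" for x
  proof
    \<comment> \<open>Returns of an isolated point of the invariant recurrent set hit the point itself, which would
        be periodic.\<close>
    assume "openin (subtopology euclidean ?R) {x}"
    then obtain U where U: "open U" "{x} = U \<inter> ?R" by (auto simp: openin_subtopology)
    then obtain m where m: "\<And>y. agree m x y \<Longrightarrow> y \<in> U"
      unfolding open_cantor_iff by blast
    obtain n where n: "n > m" "agree m x ((h ^^ n) x)" using x recurrent_iff by blast
    have "(h ^^ n) x \<in> ?CR"
      using x unfolding eq by (induction n) (auto intro: chain_recurrent_commuting_image[OF cont])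
    then have "(h ^^ n) x = x" using U(2) m[OF n(2)] eq by blast
    then have "x \<in> cantor.periodic_points h"
      using n(1) by (auto simp: cantor.periodic_points_def intro!: exI[of _ n])
    then show False using dyn(1) by blast
  qed
  moreover have "?R \<noteq> {}" using nonwandering_points_nonempty[of h] eq(1) by simp
  ultimately have "Cantor_set_in euclidean ?R" by (simp add: Cantor_space_def)
  then show ?thesis using dyn(1,3) eq by simp
qed

end
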